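(* Let $m$ and $n$ be positive integers. Then, modulo $\Phi_n(q)^2$, \[ T_1(mn,(m-1)n,q)\equiv 2m-nm(2m-1)(1-q^n)+(-1)^n\bigl((1+(-1)^n)(m-1)+1\bigr)\bigl(mq^n-nm(m-1)(1-q^n)+2m(\mathcal{B}_n(q)-1)\bigr). \]
   Context: For integers $n,k$ the $q$-binomial coefficient is ${n\brack k}={n\brack k}_q=\frac{(1-q^n)(1-q^{n-1})\cdots(1-q^{n-k+1})}{(1-q)(1-q^2)\cdots(1-q^k)}$ if $0\le k\le n$, and $0$ otherwise; ${n\brack k}_{q^2}$ denotes the same with $q$ replaced by $q^2$. The $q$-trinomial coefficient of Andrews and Baxter is \[ T_1(N,M,q)=\sum_{k=0}^{N}(-q)^k{N\brack k}_{q^2}{2N-2k\brack N-M-k}. \] $\Phi_n(q)$ is the $n$th cyclotomic polynomial. For rational functions $A(q),B(q)$ and a polynomial $P(q)\in\mathbb{Z}[q]$, $A(q)\equiv B(q)\pmod{P(q)}$ means that $A(q)-B(q)$, written as a quotient $A_1(q)/A_2(q)$, has numerator divisible by $P(q)$ and denominator coprime to $P(q)$. Define, for a positive integer $n$, \[ \mathcal{B}_n(q)=\begin{cases}(-1)^r(1+q^{2r})q^{r(3r-5)/2}, & n=3r,\\ (-1)^rq^{r(3r+1)/2}, & n=3r+1,\\ (-1)^{r+1}q^{(r-1)(3r+2)/2}, & n=3r+2.\end{cases} \] *)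

theory Defs
  imports "HOL-Computational_Algebra.Computational_Algebra"
begin

definition qbinom :: "'a::field \<Rightarrow> int \<Rightarrow> int \<Rightarrow> 'a" where
  "qbinom q n k =
     (if 0 \<le> k \<and> k \<le> n
      then (\<Prod>i=1..nat k. 1 - q ^ nat (n - int i + 1)) / (\<Prod>i=1..nat k. 1 - q ^ i)
      else 0)"

definition T1 :: "nat \<Rightarrow> int \<Rightarrow> 'a::field \<Rightarrow> 'a" where
  "T1 N M q =
     (\<Sum>k=0..N. (- q) ^ k * qbinom (q\<^sup>2) (int N) (int k)
                  * qbinom q (2 * int N - 2 * int k) (int N - M - int k))"

(* The halved exponents are always integers, but may be negative (-1 for n = 2 and n = 3). *)
definition Bn :: "nat \<Rightarrow> 'a::field \<Rightarrow> 'a" where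
  "Bn n q =
     (let r = n div 3; s = int r in
      if n mod 3 = 0 then (-1) ^ r * (1 + q ^ (2 * r)) * q powi (s * (3 * s - 5) div 2)
      else if n mod 3 = 1 then (-1) ^ r * q powi (s * (3 * s + 1) div 2)
      else (-1) ^ (r + 1) * q powi ((s - 1) * (3 * s + 2) div 2))"

definition primitive_roots :: "nat \<Rightarrow> complex set" where
  "primitive_roots n = {z. z ^ n = 1 \<and> (\<forall>k. 0 < k \<and> k < n \<longrightarrow> z ^ k \<noteq> 1)}"

definition cyclotomic :: "nat \<Rightarrow> int poly" where
  "cyclotomic n = (THE p. map_poly of_int p = (\<Prod>z\<in>primitive_roots n. [:- z, 1:]))"

definition qvar :: "int poly fract" where
  "qvar = to_fract [:0, 1:]"

definition ratfun_cong :: "int poly fract \<Rightarrow> int poly fract \<Rightarrow> int poly \<Rightarrow> bool" where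
  "ratfun_cong A B P \<longleftrightarrow>
     (\<exists>A1 A2. A2 \<noteq> 0 \<and> A - B = Fract A1 A2 \<and> P dvd A1 \<and> coprime A2 P)"

lemma primitive_roots_disjoint:
  assumes "d > 0" "e > 0" "d \<noteq> e"
  shows "primitive_roots d \<inter> primitive_roots e = {}"
proof (rule equals0I)
  fix z assume "z \<in> primitive_roots d \<inter> primitive_roots e"
  hence "z ^ d = 1" "z ^ e = 1" "\<not> e < d" "\<not> d < e"
    using assms(1,2) by (auto simp: primitive_roots_def)
  thus False using assms(3) by simp
qed

lemma roots_of_unity_decomp:
  assumes "n > 0"
  shows "{z::complex. z ^ n = 1} = (\<Union>d\<in>{d. d dvd n}. primitive_roots d)"
proof (intro equalityI subsetI)
  fix z :: complex assume z: "z \<in> {z. z ^ n = 1}"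
  define d where "d = (LEAST k. 0 < k \<and> z ^ k = 1)"
  have d: "0 < d \<and> z ^ d = 1"
    unfolding d_def by (rule LeastI[of _ n]) (use z assms in auto)
  have least: "z ^ k \<noteq> 1" if "0 < k" "k < d" for k
    using not_less_Least[of k "\<lambda>k. 0 < k \<and> z ^ k = 1"] that by (auto simp: d_def)
  have "z ^ n = z ^ (d * (n div d) + n mod d)" by simp
  also have "\<dots> = z ^ (n mod d)" using d by (simp only: power_add power_mult) simp
  finally have "z ^ (n mod d) = 1" using z by simp
  hence "n mod d = 0" using least[of "n mod d"] d by auto
  thus "z \<in> (\<Union>d\<in>{d. d dvd n}. primitive_roots d)"
    using d least by (auto simp: primitive_roots_def dvd_eq_mod_eq_0)
next
  fix z assume "z \<in> (\<Union>d\<in>{d. d dvd n}. primitive_roots d)"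
  then obtain d k where "n = d * k" "z ^ d = 1" by (auto simp: primitive_roots_def)
  thus "z \<in> {z. z ^ n = 1}" by (simp add: power_mult)
qed

lemma finite_primitive_roots: "n > 0 \<Longrightarrow> finite (primitive_roots n)"
  by (rule finite_subset[of _ "{z. z ^ n = 1}"]) (auto simp: primitive_roots_def finite_roots_unity)

lemma prod_primitive_roots:
  assumes "n > 0"
  shows "(\<Prod>d | d dvd n. \<Prod>z\<in>primitive_roots d. [:- z, 1:]) = monom (1::complex) n - 1"
proof -
  let ?p = "monom (1::complex) n - 1"
  have pos: "d > 0" if "d dvd n" for d using that assms by (rule dvd_pos_nat[rotated])
  have poly: "poly ?p z = z ^ n - 1" for z by (simp add: poly_monom)
  have deg: "degree ?p = n"
    using degree_add_eq_left[of "-1" "monom (1::complex) n"] assms by (simp add: degree_monom_eq)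
  have lead: "lead_coeff ?p = 1" using assms by (simp add: deg)
  have "rsquarefree ?p"
    unfolding rsquarefree_roots
  proof (intro allI notI, elim conjE)
    fix a assume "poly ?p a = 0" "poly (pderiv ?p) a = 0"
    thus False using assms
      by (cases "a = 0") (auto simp: poly pderiv_diff pderiv_monom poly_monom zero_power)
  qed
  from complex_poly_decompose_rsquarefree[OF this]
  have "?p = (\<Prod>z | poly ?p z = 0. [:- z, 1:])"
    unfolding lead smult_1_left by (rule sym)
  also have "{z. poly ?p z = 0} = {z. z ^ n = 1}" unfolding poly by simp
  also have "(\<Prod>z | z ^ n = 1. [:- z, 1:]) = (\<Prod>d | d dvd n. \<Prod>z\<in>primitive_roots d. [:- z, 1:])"
    unfolding roots_of_unity_decomp[OF assms]
  proof (rule prod.UNION_disjoint)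
    show "\<forall>d\<in>{d. d dvd n}. finite (primitive_roots d)"
      by (auto intro: finite_primitive_roots pos)
    show "\<forall>d\<in>{d. d dvd n}. \<forall>e\<in>{d. d dvd n}. d \<noteq> e \<longrightarrow> primitive_roots d \<inter> primitive_roots e = {}"
      by (intro ballI impI primitive_roots_disjoint) (auto intro: pos)
  qed (use assms in simp)
  finally show ?thesis by (rule sym)
qed

lemma cyclotomic_exists:
  assumes "n > 0"
  shows "\<exists>p :: int poly. lead_coeff p = 1 \<and> map_poly of_int p = (\<Prod>z\<in>primitive_roots n. [:- z, 1:])"
  using assms
proof (induction n rule: less_induct)
  case (less n)
  let ?C = "\<lambda>d. \<Prod>z\<in>primitive_roots d. [:- z, 1:]"
  let ?D = "{d. d dvd n \<and> d \<noteq> n}"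
  have D: "{d. d dvd n} = insert n ?D" "finite ?D" using less.prems by auto
  have "\<exists>p :: int poly. lead_coeff p = 1 \<and> map_poly of_int p = ?C d" if "d \<in> ?D" for d
    using less.IH[of d] that less.prems dvd_imp_le[of d n] dvd_pos_nat[of n d] by force
  then obtain f :: "nat \<Rightarrow> int poly"
    where f: "\<And>d. d \<in> ?D \<Longrightarrow> lead_coeff (f d) = 1 \<and> map_poly of_int (f d) = ?C d" by metis
  define g where "g = (\<Prod>d\<in>?D. f d)"
  have g1: "lead_coeff g = 1" unfolding g_def lead_coeff_prod using f by simp
  have map_mult: "map_poly of_int (p * q) = (map_poly of_int p * map_poly of_int q :: complex poly)"
    for p q :: "int poly" by (rule poly_eqI) (simp add: coeff_map_poly coeff_mult)
  have map_prod: "map_poly of_int (prod h A) = (\<Prod>d\<in>A. map_poly of_int (h d) :: complex poly)"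
    for h :: "nat \<Rightarrow> int poly" and A
    by (induction A rule: infinite_finite_induct) (auto simp: map_mult)
  have gC: "map_poly of_int g = (\<Prod>d\<in>?D. ?C d)" unfolding g_def map_prod using f by simp
  obtain s r where sr: "pseudo_divmod (monom 1 n - 1) g = (s, r)" by fastforce
  have g0: "g \<noteq> 0" using g1 by auto
  from pseudo_divmod[OF g0 sr] g1
  have eq: "monom 1 n - 1 = g * s + r" and r: "r = 0 \<or> degree r < degree g" by auto
  let ?i = "map_poly of_int :: int poly \<Rightarrow> complex poly"
  have deg: "degree (?i p) = degree p" for p by (simp add: degree_map_poly)
  have "?i (monom 1 n - 1) = monom 1 n - 1"
    by (rule poly_eqI) (simp add: coeff_map_poly)
  also have "\<dots> = ?C n * ?i g"
    unfolding prod_primitive_roots[OF less.prems, symmetric] D(1) gC using D(2) by simp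
  also have "?i (monom 1 n - 1) = ?i g * ?i s + ?i r"
    unfolding eq map_mult[symmetric] by (rule poly_eqI) (simp add: coeff_map_poly)
  finally have e: "?i r = ?i g * (?C n - ?i s)" by (simp add: algebra_simps)
  have ig0: "?i g \<noteq> 0" using gC finite_primitive_roots
    by (metis g0 g1 coeff_map_poly of_int_1 of_int_0 zero_neq_one coeff_0)
  have "?C n - ?i s = 0"
  proof (rule ccontr)
    assume nz: "?C n - ?i s \<noteq> 0"
    hence "degree (?i r) = degree g + degree (?C n - ?i s)"
      using e degree_mult_eq[OF ig0 nz] deg by simp
    moreover have "r \<noteq> 0" using e nz ig0 by auto
    ultimately show False using r deg by simp
  qed
  hence s: "?i s = ?C n" by simp
  have "lead_coeff (?C n) = 1" by (simp add: lead_coeff_prod)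
  hence "of_int (lead_coeff s) = (1::complex)" unfolding s[symmetric] deg by (simp add: coeff_map_poly)
  hence "lead_coeff s = 1" by simp
  thus ?case using s by blast
qed

lemma map_poly_cyclotomic:
  assumes "n > 0"
  shows "map_poly of_int (cyclotomic n) = (\<Prod>z\<in>primitive_roots n. [:- z, 1:])"
proof -
  obtain p :: "int poly" where p: "map_poly of_int p = (\<Prod>z\<in>primitive_roots n. [:- z, 1:])"
    using cyclotomic_exists[OF assms] by blast
  have uniq: "q = p"
    if "map_poly of_int q = (\<Prod>z\<in>primitive_roots n. [:- z, 1:])" for q :: "int poly"
    using that unfolding p[symmetric] by (simp add: poly_eq_iff coeff_map_poly)
  show ?thesis unfolding cyclotomic_def by (rule theI[of _ p]) (fact p, rule uniq)
qed

end

(* Write q^n = 1 - e; e is divisible by Phi_n(q), so all quantities matter only to first order in e.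
   The summands k = 0 and k = n of T_1(mn, (m-1)n, q) are q-binomial coefficients of multiples of n
   and are expanded directly.  With k = n - j, the remaining summands with j > n/2 are divisible by
   e^2, and those with j <= n/2 are a common factor times
     (-1)^j q^(j(j-3)/2) (1-q^n)/(1-q^(n-j)) [n-j, j],
   where for even n the extra factor 2m - 1 appears because q^2 has order n/2 only.
   Summed over 0 <= j <= n/2, these terms give exactly B_n(q) = a_n - a_(n-2)/q, where
   a_n = sum_j (-1)^j q^(j choose 2) [n-j, j] satisfies a_n = -q^(n-2) a_(n-3). *)

theory Submission
  imports Defs
begin

section \<open>Identities for q-binomial coefficients\<close>

text \<open>A summand with 0 < k < n is divisible by Phi_n, so modulo Phi_n^2 only the value of its
  cofactor modulo Phi_n matters, and it may be replaced by any term with an equivalent cofactor. The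
  replacements are chosen so that their sum can be evaluated exactly as a rational function: the
  quotient (1-q^n)/(1-q^(n-j)) makes them a q-Lucas sum, which splits into two q-Fibonacci sums. A
  summand and its replacement meet in the central coefficient [2j, j], reached on one side from
  q^(2mn-2k) = q^(2j) and on the other from q^(n-s) = q^(-s), both modulo Phi_n. The obstacle is
  division: some q-binomials have multiples of Phi_n in numerator and denominator and cannot be
  reduced factor by factor. Such quotients are cancelled as geometric sums beforehand or, for
  [mn, n] in base q^2 with n even, avoided by multiplying with a unit. The ambient ring consists of
  the fractions whose denominators do not vanish at primitive n-th roots of unity. There 1 - q^i is
  invertible unless n divides i, and so are positive integers, which accounts for the halves in
  a(a-1)/2.\<close>

lemma geometric_quotient:
  fixes P :: "'a::field"
  assumes "P \<noteq> 1"
  shows "(1 - P ^ a) / (1 - P) = (\<Sum>i<a. P ^ i)"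
proof -
  have "1 - P \<noteq> 0" using assms by simp
  thus ?thesis unfolding one_diff_power_eq[of P] by (rule nonzero_mult_div_cancel_left)
qed

lemma minus_power_mult_sign:
  fixes x :: "'a::comm_ring_1"
  assumes "k > 0"
  shows "(- x) ^ k * (- 1) ^ (k - 1) = - (x ^ k)"
  using assms by (cases k) (simp_all add: power_minus[of x] mult_ac)

lemma not_dvd_double:
  fixes l n :: nat
  assumes "0 < l" "l < n" "2 * l \<noteq> n"
  shows "\<not> n dvd 2 * l"
proof
  assume "n dvd 2 * l"
  then obtain c where c: "2 * l = n * c" by (elim dvdE)
  have "\<not> n * 2 \<le> n * c" using c assms by linarith
  hence "c < 2" by (metis mult_le_mono2 not_le)
  thus False using c assms by (cases c) auto
qed

section \<open>Product forms and Pascal rules\<close>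

lemma qbinom_conv_prod:
  fixes q :: "'a::field"
  assumes "k \<le> n"
  shows "qbinom q (int n) (int k) = (\<Prod>i=1..k. (1 - q ^ (n + 1 - i)) / (1 - q ^ i))"
proof -
  have "(\<Prod>i=1..k. 1 - q ^ nat (int n - int i + 1)) = (\<Prod>i=1..k. 1 - q ^ (n + 1 - i))"
  proof (rule prod.cong)
    fix i assume "i \<in> {1..k}"
    hence "nat (int n - int i + 1) = n + 1 - i" using assms by auto
    thus "1 - q ^ nat (int n - int i + 1) = 1 - q ^ (n + 1 - i)" by (simp only:)
  qed simp
  thus ?thesis using assms by (simp add: qbinom_def prod_dividef)
qed

lemma qbinom_eq_0: "b < 0 \<or> a < b \<Longrightarrow> qbinom q a b = 0"
  by (auto simp: qbinom_def)

lemma qbinom_0_right: "a \<ge> 0 \<Longrightarrow> qbinom q a 0 = 1"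
  by (simp add: qbinom_def)

lemma qbinom_conv_prod_rev:
  fixes q :: "'a::field"
  shows "qbinom q (int (m + k)) (int k) = (\<Prod>i=1..k. (1 - q ^ (m + i)) / (1 - q ^ i))"
proof -
  have "(\<Prod>i=1..k. 1 - q ^ (m + k + 1 - i)) = (\<Prod>i=1..k. 1 - q ^ (m + i))"
    by (rule prod.reindex_bij_witness[of _ "\<lambda>i. k + 1 - i" "\<lambda>i. k + 1 - i"])
       (auto intro!: arg_cong[where f = "\<lambda>x. q ^ x"])
  thus ?thesis unfolding qbinom_conv_prod[OF le_add2] by (simp add: prod_dividef)
qed

lemma qbinom_Suc_right:
  fixes q :: "'a::field"
  assumes "k < n"
  shows "qbinom q (int n) (int (Suc k)) = qbinom q (int n) (int k) * ((1 - q ^ (n - k)) / (1 - q ^ Suc k))"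
  using assms by (simp add: qbinom_conv_prod del: of_nat_Suc)

lemma qbinom_Suc_Suc:
  fixes q :: "'a::field"
  assumes "k \<le> n"
  shows "qbinom q (int (Suc n)) (int (Suc k)) = qbinom q (int n) (int k) * ((1 - q ^ Suc n) / (1 - q ^ Suc k))"
proof -
  have "(\<Prod>i=1..Suc k. 1 - q ^ (Suc n + 1 - i)) = (1 - q ^ Suc n) * (\<Prod>i=Suc 1..Suc k. 1 - q ^ (Suc n + 1 - i))"
    by (subst prod.atLeast_Suc_atMost) simp_all
  also have "(\<Prod>i=Suc 1..Suc k. 1 - q ^ (Suc n + 1 - i)) = (\<Prod>i=1..k. 1 - q ^ (n + 1 - i))"
    unfolding prod.shift_bounds_cl_Suc_ivl by simp
  finally show ?thesis
    using assms by (simp add: qbinom_conv_prod prod_dividef del: of_nat_Suc)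
qed

text \<open>The pairing of \<open>1 - q ^ (n - i)\<close> with \<open>1 - q ^ i\<close> is made for
  reduction: if \<open>q ^ n\<close> is congruent to 1, a generic factor becomes
  \<open>- 1 / q ^ i\<close>, and the divisibility by Phi_n is isolated in the head factor.\<close>

lemma qbinom_conv_prod_head:
  fixes q :: "'a::field"
  assumes "0 < k" "k \<le> n"
  shows "qbinom q (int n) (int k) =
    (1 - q ^ n) / (1 - q ^ k) * (\<Prod>i=1..<k. (1 - q ^ (n - i)) / (1 - q ^ i))"
proof -
  obtain k' where k: "k = Suc k'" using assms(1) by (cases k) auto
  have "(\<Prod>i=1..k. 1 - q ^ (n + 1 - i)) = (1 - q ^ n) * (\<Prod>i=Suc 1..Suc k'. 1 - q ^ (n + 1 - i))"
    unfolding k by (subst prod.atLeast_Suc_atMost) simp_all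
  also have "(\<Prod>i=Suc 1..Suc k'. 1 - q ^ (n + 1 - i)) = (\<Prod>i=1..<k. 1 - q ^ (n - i))"
    unfolding prod.shift_bounds_cl_Suc_ivl k atLeastLessThanSuc_atLeastAtMost by simp
  finally have num: "(\<Prod>i=1..k. 1 - q ^ (n + 1 - i)) = (1 - q ^ n) * (\<Prod>i=1..<k. 1 - q ^ (n - i))" .
  have "(\<Prod>i=1..k. 1 - q ^ i) = (1 - q ^ k) * (\<Prod>i=1..<k. 1 - q ^ i)"
    unfolding k atLeastLessThanSuc_atLeastAtMost by simp
  thus ?thesis unfolding qbinom_conv_prod[OF assms(2)] prod_dividef num by simp
qed

lemma qbinom_self:
  fixes q :: "'a::field"
  assumes "\<forall>i>0. q ^ i \<noteq> 1"
  shows "qbinom q (int n) (int n) = 1"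
  using qbinom_conv_prod_rev[of q 0 n] assms by simp

lemma qbinom_neq_0:
  fixes q :: "'a::field"
  assumes "\<forall>i>0. q ^ i \<noteq> 1"
  shows "qbinom q (int (m + k)) (int k) \<noteq> 0"
  unfolding qbinom_conv_prod_rev using assms by simp

lemma qbinom_pascal1:
  fixes q :: "'a::field"
  assumes q: "\<forall>i>0. q ^ i \<noteq> 1"
  shows "qbinom q (a + 1) (int (Suc k)) = qbinom q a (int (Suc k)) + q ^ nat (a - int k) * qbinom q a (int k)"
proof (cases "int k \<le> a")
  case True
  then obtain n where n: "a = int n" "k \<le> n" by (metis nat_int nat_0_le of_nat_0_le_iff of_nat_le_iff order_trans)
  have a: "a + 1 = int (Suc n)" "nat (a - int k) = n - k" using n by auto
  have nz: "1 - q ^ Suc k \<noteq> 0" using q by (simp del: power_Suc)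
  show ?thesis
  proof (cases "k = n")
    case True
    thus ?thesis unfolding a unfolding n
      by (simp only: qbinom_self[OF q] diff_self_eq_0) (simp add: qbinom_eq_0)
  next
    case False
    have "q ^ Suc n = q ^ (n - k) * q ^ Suc k" using n by (simp flip: power_add)
    moreover have "k < n" using False n by simp
    ultimately show ?thesis unfolding a unfolding n
      using nz by (simp only: qbinom_Suc_Suc[OF n(2)] qbinom_Suc_right)
        (simp add: field_simps del: of_nat_Suc power_Suc)
  qed
qed (simp add: qbinom_eq_0)

lemma qbinom_pascal2:
  fixes q :: "'a::field"
  assumes q: "\<forall>i>0. q ^ i \<noteq> 1"
  shows "qbinom q (a + 1) (int (Suc k)) = q ^ Suc k * qbinom q a (int (Suc k)) + qbinom q a (int k)"
proof (cases "int k \<le> a")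
  case True
  then obtain n where n: "a = int n" "k \<le> n" by (metis nat_int nat_0_le of_nat_0_le_iff of_nat_le_iff order_trans)
  have a: "a + 1 = int (Suc n)" using n by auto
  have nz: "1 - q ^ Suc k \<noteq> 0" using q by (simp del: power_Suc)
  show ?thesis
  proof (cases "k = n")
    case True
    thus ?thesis unfolding a unfolding n
      by (simp only: qbinom_self[OF q] diff_self_eq_0) (simp add: qbinom_eq_0)
  next
    case False
    have "q ^ Suc n = q ^ (n - k) * q ^ Suc k" using n by (simp flip: power_add)
    moreover have "k < n" using False n by simp
    ultimately show ?thesis unfolding a unfolding n
      using nz by (simp only: qbinom_Suc_Suc[OF n(2)] qbinom_Suc_right)
        (simp add: field_simps del: of_nat_Suc power_Suc)
  qed
qed (simp add: qbinom_eq_0)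

section \<open>Alternating q-Fibonacci sums\<close>

definition fib_sum :: "nat \<Rightarrow> nat \<Rightarrow> 'a::field \<Rightarrow> 'a" where
  "fib_sum c n q = (\<Sum>j\<le>n. (-1) ^ j * q ^ ((j choose 2) + c * j) * qbinom q (int n - int j) (int j))"

lemma fib_sum_split:
  "fib_sum c (Suc n) q =
     1 + (\<Sum>j\<le>n. (-1) ^ Suc j * q ^ ((Suc j choose 2) + c * Suc j) * qbinom q (int n - int j) (int (Suc j)))"
  unfolding fib_sum_def sum.atMost_Suc_shift by (simp add: qbinom_0_right binomial_eq_0)

lemma fib_sum_extend:
  "fib_sum c n q = (\<Sum>j\<le>Suc n. (-1) ^ j * q ^ ((j choose 2) + c * j) * qbinom q (int n - int j) (int j))"
  unfolding fib_sum_def by (simp add: qbinom_eq_0)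

lemma Suc_choose_2: "Suc j choose 2 = (j choose 2) + j"
  by (simp add: numeral_2_eq_2)

text \<open>\<open>fib_sum 0\<close> is \<open>a_n\<close>; \<open>fib_sum 1\<close> is a companion
  that arises because the factor \<open>q ^ Suc j\<close> of \<open>qbinom_pascal2\<close> raises
  \<open>c\<close> from 0 to 1.\<close>

lemma fib_sum_0_rec:
  fixes q :: "'a::field"
  assumes q: "\<forall>i>0. q ^ i \<noteq> 1"
  shows "fib_sum 0 (Suc (Suc n)) q = fib_sum 1 (Suc n) q - fib_sum 1 n q"
proof -
  have "(-1) ^ Suc j * q ^ ((Suc j choose 2) + 0 * Suc j) * qbinom q (int (Suc n) - int j) (int (Suc j)) =
     (-1) ^ Suc j * q ^ ((Suc j choose 2) + 1 * Suc j) * qbinom q (int n - int j) (int (Suc j))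
     - (-1) ^ j * q ^ ((j choose 2) + 1 * j) * qbinom q (int n - int j) (int j)" for j
  proof -
    have "int (Suc n) - int j = (int n - int j) + 1" by simp
    thus ?thesis
      by (simp only: qbinom_pascal2[OF q] Suc_choose_2) (simp add: power_add algebra_simps)
  qed
  hence "fib_sum 0 (Suc (Suc n)) q = 
     (1 + (\<Sum>j\<le>Suc n. (-1) ^ Suc j * q ^ ((Suc j choose 2) + 1 * Suc j) * qbinom q (int n - int j) (int (Suc j))))
     - fib_sum 1 n q"
    unfolding fib_sum_split[of 0 "Suc n"] fib_sum_extend[of 1 n] by (simp only: sum_subtractf) simp
  also have "(\<Sum>j\<le>Suc n. (-1) ^ Suc j * q ^ ((Suc j choose 2) + 1 * Suc j) * qbinom q (int n - int j) (int (Suc j)))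
    = (\<Sum>j\<le>n. (-1) ^ Suc j * q ^ ((Suc j choose 2) + 1 * Suc j) * qbinom q (int n - int j) (int (Suc j)))"
    by (simp add: qbinom_eq_0)
  finally show ?thesis unfolding fib_sum_split[of 1 n] .
qed

text \<open>The other Pascal rule contributes q^(n-2j). Added to (j+1 choose 2) + (j+1), its
  exponent gives (j choose 2) + (n+1), so \<open>c\<close> falls back to 0 and q^(n+1) comes out as
  a common factor.\<close>

lemma fib_sum_1_rec:
  fixes q :: "'a::field"
  assumes q: "\<forall>i>0. q ^ i \<noteq> 1"
  shows "fib_sum 1 (Suc (Suc n)) q = fib_sum 1 (Suc n) q - q ^ Suc n * fib_sum 0 n q"
proof -
  have "(-1) ^ Suc j * q ^ ((Suc j choose 2) + 1 * Suc j) * qbinom q (int (Suc n) - int j) (int (Suc j)) =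
     (-1) ^ Suc j * q ^ ((Suc j choose 2) + 1 * Suc j) * qbinom q (int n - int j) (int (Suc j))
     - q ^ Suc n * ((-1) ^ j * q ^ ((j choose 2) + 0 * j) * qbinom q (int n - int j) (int j))" for j
  \<comment> \<open>For 2j > n the exponent n - 2j would be truncated by \<open>nat\<close>, but
    then all three q-binomials are 0.\<close>
  proof (cases "2 * j \<le> n")
    case True
    have "int (Suc n) - int j = (int n - int j) + 1" by simp
    moreover have "q ^ Suc n = q ^ nat (int n - int j - int j) * q ^ j * q ^ Suc j"
      unfolding power_add[symmetric] using True by (intro arg_cong[where f = "\<lambda>x. q ^ x"]) simp
    ultimately show ?thesis
      by (simp only: qbinom_pascal1[OF q] Suc_choose_2) (simp add: power_add algebra_simps)
  next
    case False
    thus ?thesis by (simp add: qbinom_eq_0)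
  qed
  hence "fib_sum 1 (Suc (Suc n)) q = 
     (1 + (\<Sum>j\<le>Suc n. (-1) ^ Suc j * q ^ ((Suc j choose 2) + 1 * Suc j) * qbinom q (int n - int j) (int (Suc j))))
     - q ^ Suc n * fib_sum 0 n q"
    unfolding fib_sum_split[of 1 "Suc n"] fib_sum_extend[of 0 n] by (simp only: sum_subtractf sum_distrib_left) simp
  also have "(\<Sum>j\<le>Suc n. (-1) ^ Suc j * q ^ ((Suc j choose 2) + 1 * Suc j) * qbinom q (int n - int j) (int (Suc j)))
    = (\<Sum>j\<le>n. (-1) ^ Suc j * q ^ ((Suc j choose 2) + 1 * Suc j) * qbinom q (int n - int j) (int (Suc j)))"
    by (simp add: qbinom_eq_0)
  finally show ?thesis unfolding fib_sum_split[of 1 n] .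
qed

text \<open>Eliminates the companion: the first recurrence expresses the left side as a difference
  of consecutive values of \<open>fib_sum 1\<close>, which the second one evaluates.\<close>

lemma fib_sum_rec:
  fixes q :: "'a::field"
  assumes q: "\<forall>i>0. q ^ i \<noteq> 1"
  shows "fib_sum 0 (n + 3) q = - (q ^ (n + 1) * fib_sum 0 n q)"
  using fib_sum_0_rec[OF q, of "Suc n"] fib_sum_1_rec[OF q, of n] by (simp add: numeral_3_eq_3)

lemma fib_sum_initial:
  fixes q :: "'a::field"
  assumes q: "\<forall>i>0. q ^ i \<noteq> 1"
  shows "fib_sum 0 0 q = 1" "fib_sum 0 1 q = 1" "fib_sum 0 2 q = 0"
  using qbinom_self[OF q, of 1]
  by (simp_all add: fib_sum_def qbinom_0_right qbinom_eq_0 binomial_eq_0 numeral_2_eq_2)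

text \<open>The exponents are the generalized pentagonal numbers r(3r-1)/2 and r(3r+1)/2,
  accumulated from the steps 3i+1 and 3i+2 of the recurrence.\<close>

lemma fib_sum_closed:
  fixes q :: "'a::field"
  assumes q: "\<forall>i>0. q ^ i \<noteq> 1"
  shows "fib_sum 0 (3 * r) q = (-1) ^ r * q ^ (3 * (r choose 2) + r)"
    and "fib_sum 0 (3 * r + 1) q = (-1) ^ r * q ^ (3 * (r choose 2) + 2 * r)"
    and "fib_sum 0 (3 * r + 2) q = 0"
proof (induction r)
  case 0
  show "fib_sum 0 (3 * 0) q = (-1) ^ 0 * q ^ (3 * (0 choose 2) + 0)"
    "fib_sum 0 (3 * 0 + 1) q = (-1) ^ 0 * q ^ (3 * (0 choose 2) + 2 * 0)"
    "fib_sum 0 (3 * 0 + 2) q = 0"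
    using fib_sum_initial[OF q] by (simp_all add: binomial_eq_0 numeral_2_eq_2)
next
  case (Suc r)
  have *: "3 * Suc r + c = (3 * r + c) + 3" for c by simp
  have **: "3 * Suc r = 3 * r + 3" by simp
  show "fib_sum 0 (3 * Suc r) q = (-1) ^ Suc r * q ^ (3 * (Suc r choose 2) + Suc r)"
    unfolding ** fib_sum_rec[OF q] Suc Suc_choose_2 by (simp add: algebra_simps flip: power_add)
  show "fib_sum 0 (3 * Suc r + 1) q = (-1) ^ Suc r * q ^ (3 * (Suc r choose 2) + 2 * Suc r)"
    unfolding * fib_sum_rec[OF q] Suc Suc_choose_2 by (simp add: algebra_simps flip: power_add)
  show "fib_sum 0 (3 * Suc r + 2) q = 0"
    unfolding * fib_sum_rec[OF q] Suc by simp
qed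

section \<open>The q-Lucas form of B_n\<close>

lemma int_choose_2: "2 * int (r choose 2) = int r * (int r - 1)"
  by (induction r) (simp_all add: Suc_choose_2 algebra_simps)

text \<open>Every third \<open>fib_sum 0\<close> vanishes, so only one of the two terms survives,
  except when 3 divides n + 2: there both do, and they produce the factor 1 + q^(2r) of B_n.\<close>

lemma Bn_conv_fib_sum:
  fixes q :: "'a::field"
  assumes q: "\<forall>i>0. q ^ i \<noteq> 1" and q0: "q \<noteq> 0" 
  shows "Bn (n + 2) q = fib_sum 0 (n + 2) q - fib_sum 0 n q / q"
proof -
  consider r where "n = 3 * r" | r where "n = 3 * r + 1" | r where "n = 3 * r + 2"
    by (metis add_0_right mod_mult_div_eq mod_less_divisor numeral_3_eq_3 zero_less_Suc less_Suc_eq less_one numeral_1_eq_Suc_0 numeral_2_eq_2 One_nat_def not_less0 add.commute)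
  thus ?thesis
  proof cases
    case (1 r)
    have d: "(3 * r + 2) div 3 = r" "(3 * r + 2) mod 3 = 2" by presburger+
    \<comment> \<open>Doubling removes the \<open>div\<close> and leaves a polynomial identity. The
      final - 1 is the division by q.\<close>
    have "2 * ((int r - 1) * (3 * int r + 2) div 2) = 2 * (int (3 * (r choose 2) + r) - 1)"
      using int_choose_2[of r] by (simp add: algebra_simps)
    hence e: "(int r - 1) * (3 * int r + 2) div 2 = int (3 * (r choose 2) + r) - 1" by simp
    show ?thesis unfolding 1 Bn_def Let_def d e fib_sum_closed[OF q] using q0
      by (simp add: power_int_diff del: of_nat_add of_nat_mult)
  next
    case (2 r)
    have n: "3 * r + 1 + 2 = 3 * Suc r" by simp
    have d: "(3 * Suc r) div 3 = Suc r" "(3 * Suc r) mod 3 = 0" by presburger+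
    have "2 * (int (Suc r) * (3 * int (Suc r) - 5) div 2) = 2 * (int (3 * (r choose 2) + 2 * r) - 1)"
      using int_choose_2[of r] by (simp add: algebra_simps)
    hence e: "int (Suc r) * (3 * int (Suc r) - 5) div 2 = int (3 * (r choose 2) + 2 * r) - 1" by simp
    have f: "3 * (Suc r choose 2) + Suc r = 2 * r + 1 + (3 * (r choose 2) + 2 * r)"
      by (simp add: Suc_choose_2)
    show ?thesis unfolding 2 n Bn_def Let_def d e fib_sum_closed[OF q] f using q0
      by (simp add: power_int_diff field_simps power_add del: of_nat_add of_nat_mult) (simp add: mult.commute flip: power_add)
  next
    case (3 r)
    have n: "3 * r + 2 + 2 = 3 * Suc r + 1" by simp
    have d: "(3 * Suc r + 1) div 3 = Suc r" "(3 * Suc r + 1) mod 3 = 1" by presburger+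
    have "2 * (int (Suc r) * (3 * int (Suc r) + 1) div 2) = 2 * (int (3 * (Suc r choose 2) + 2 * Suc r))"
      using int_choose_2[of "Suc r"] by (simp add: algebra_simps)
    hence e: "int (Suc r) * (3 * int (Suc r) + 1) div 2 = int (3 * (Suc r choose 2) + 2 * Suc r)" by simp
    define K where "K = 3 * (Suc r choose 2) + 2 * Suc r"
    show ?thesis unfolding 3 n Bn_def Let_def d e fib_sum_closed[OF q] K_def[symmetric] by simp
  qed
qed

lemma qbinom_lucas:
  fixes q :: "'a::field"
  assumes q: "\<forall>i>0. q ^ i \<noteq> 1" and "0 < j" "2 * j \<le> n"
  shows "(1 - q ^ n) / (1 - q ^ (n - j)) * qbinom q (int n - int j) (int j) =
    q ^ j * qbinom q (int n - int j) (int j) + qbinom q (int n - int j - 1) (int j - 1)"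
proof -
  obtain i where i: "j = Suc i" using assms(2) by (cases j) auto
  obtain m where m: "n - j = Suc m" "i \<le> m" using assms i by (cases "n - j") auto
  have a: "int n - int j = int (Suc m)" "int n - int j - 1 = int m" "int j - 1 = int i"
    using m i assms by auto
  have n: "q ^ n = q ^ Suc m * q ^ Suc i"
    unfolding power_add[symmetric] using m i assms(3) by (intro arg_cong[where f = "\<lambda>x. q ^ x"]) simp
  \<comment> \<open>With x = q^j and y = q^(n-j) this rests on 1 - xy = x(1 - y) + (1 - x). It is
    the q-analogue of splitting the Lucas coefficient n/(n-j) * binom(n-j, j) into two
    binomials.\<close>
  have *: "(1 - y * x) / (1 - y) * (b * ((1 - y) / (1 - x))) = x * (b * ((1 - y) / (1 - x))) + b"
    if "x \<noteq> 1" "y \<noteq> 1" for x y b :: 'a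
    using that by (simp add: divide_simps) (simp add: algebra_simps)
  have "q ^ Suc i \<noteq> 1" "q ^ Suc m \<noteq> 1" using q by blast+
  from *[OF this] show ?thesis unfolding a(2,3) unfolding a(1) m(1) unfolding i n qbinom_Suc_Suc[OF m(2)] .
qed

text \<open>The q-Lucas coefficient splits into two q-binomials. After division by q^j the first
  part is a term of a_n; since (j choose 2) - j = (j-1 choose 2) - 1, the second is a term of
  -a_(n-2)/q with index j - 1.\<close>

lemma Bn_expansion:
  fixes q :: "'a::field"
  assumes q: "\<forall>i>0. q ^ i \<noteq> 1" and q0: "q \<noteq> 0" and "n > 0"
  shows "Bn n q = 1 + (\<Sum>j=1..n div 2. (-1) ^ j * q ^ (j choose 2) / q ^ j * ((1 - q ^ n) / (1 - q ^ (n - j)))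
                      * qbinom q (int n - int j) (int j))"
\<comment> \<open>The sum a_(n-2) requires n >= 2. For n = 1 the sum over j is empty and B_1 =
  1.\<close>
proof (cases "n = 1")
  case True
  thus ?thesis by (simp add: Bn_def)
next
  case False
  then obtain m where m: "n = Suc (Suc m)" using assms(3) by (metis One_nat_def gr0_implies_Suc not_gr0)
  have nz: "q ^ j \<noteq> 0" for j using q0 by simp
  have "(-1) ^ Suc j * q ^ (Suc j choose 2) / q ^ Suc j * ((1 - q ^ n) / (1 - q ^ (n - Suc j)))
          * qbinom q (int n - int (Suc j)) (int (Suc j))
     = (-1) ^ Suc j * q ^ ((Suc j choose 2) + 0 * Suc j) * qbinom q (int (Suc m) - int j) (int (Suc j))
       - ((-1) ^ j * q ^ ((j choose 2) + 0 * j) * qbinom q (int m - int j) (int j)) / q"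
    if "j < n div 2" for j
  proof -
    have a: "int n - int (Suc j) - 1 = int m - int j" "int (Suc j) - 1 = int j" "int n - int (Suc j) = int (Suc m) - int j"
      using m by auto
    have "2 * Suc j \<le> n" using that by simp
    note L = qbinom_lucas[OF q _ this, unfolded a]
    have "(-1) ^ Suc j * q ^ (Suc j choose 2) / q ^ Suc j * ((1 - q ^ n) / (1 - q ^ (n - Suc j)))
          * qbinom q (int n - int (Suc j)) (int (Suc j)) =
        (-1) ^ Suc j * q ^ (Suc j choose 2) / q ^ Suc j * ((1 - q ^ n) / (1 - q ^ (n - Suc j))
          * qbinom q (int (Suc m) - int j) (int (Suc j)))"
      unfolding a(3) by (simp only: mult.assoc)
    also have "\<dots> = (-1) ^ Suc j * q ^ (Suc j choose 2) / q ^ Suc j * 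
        (q ^ Suc j * qbinom q (int (Suc m) - int j) (int (Suc j)) + qbinom q (int m - int j) (int j))"
      by (subst L) simp_all
    also have "\<dots> = (-1) ^ Suc j * q ^ (Suc j choose 2) * qbinom q (int (Suc m) - int j) (int (Suc j))
         + (-1) ^ Suc j * (q ^ (j choose 2) * q ^ j) / q ^ Suc j * qbinom q (int m - int j) (int j)"
      using nz[of "Suc j"] by (simp add: distrib_left Suc_choose_2 power_add del: power_Suc)
    also have "(-1) ^ Suc j * (q ^ (j choose 2) * q ^ j) / q ^ Suc j = - ((-1) ^ j * q ^ (j choose 2) / q)"
      using q0 by (simp add: field_simps)
    finally show ?thesis by simp
  qed
  hence "(\<Sum>j<n div 2. (-1) ^ Suc j * q ^ (Suc j choose 2) / q ^ Suc j * ((1 - q ^ n) / (1 - q ^ (n - Suc j)))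
          * qbinom q (int n - int (Suc j)) (int (Suc j))) =
      (\<Sum>j<n div 2. (-1) ^ Suc j * q ^ ((Suc j choose 2) + 0 * Suc j) * qbinom q (int (Suc m) - int j) (int (Suc j)))
       - (\<Sum>j<n div 2. (-1) ^ j * q ^ ((j choose 2) + 0 * j) * qbinom q (int m - int j) (int j)) / q"
    by (simp only: sum_subtractf[symmetric] sum_divide_distrib) (rule sum.cong, simp_all)
  also have "(\<Sum>j<n div 2. (-1) ^ Suc j * q ^ ((Suc j choose 2) + 0 * Suc j) * qbinom q (int (Suc m) - int j) (int (Suc j)))
     = (\<Sum>j\<le>Suc m. (-1) ^ Suc j * q ^ ((Suc j choose 2) + 0 * Suc j) * qbinom q (int (Suc m) - int j) (int (Suc j)))"
    by (rule sum.mono_neutral_left) (auto simp: m intro!: qbinom_eq_0)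
  also have "\<dots> = fib_sum 0 n q - 1" unfolding m fib_sum_split[of 0 "Suc m"] by simp
  also have "(\<Sum>j<n div 2. (-1) ^ j * q ^ ((j choose 2) + 0 * j) * qbinom q (int m - int j) (int j))
    = fib_sum 0 m q" unfolding fib_sum_def
    by (rule sum.mono_neutral_left) (auto simp: m intro!: qbinom_eq_0)
  also have "fib_sum 0 n q - 1 - fib_sum 0 m q / q = Bn n q - 1"
    using Bn_conv_fib_sum[OF q q0, of m] m by simp
  also have "(\<Sum>j<n div 2. (-1) ^ Suc j * q ^ (Suc j choose 2) / q ^ Suc j * ((1 - q ^ n) / (1 - q ^ (n - Suc j)))
          * qbinom q (int n - int (Suc j)) (int (Suc j)))
      = (\<Sum>j=1..n div 2. (-1) ^ j * q ^ (j choose 2) / q ^ j * ((1 - q ^ n) / (1 - q ^ (n - j)))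
          * qbinom q (int n - int j) (int j))"
    by (rule sum.reindex_bij_witness[of _ "\<lambda>j. j - 1" Suc]) auto
  finally show ?thesis by (simp add: algebra_simps)
qed

section \<open>Product identities behind the reductions modulo Phi_n\<close>

lemma double_choose_2: "2 * (k choose 2) = k * (k - 1)"
proof -
  have "int (2 * (k choose 2)) = int (k * (k - 1))"
    using int_choose_2[of k] by (cases k) (simp_all add: algebra_simps)
  thus ?thesis by (simp only: of_nat_eq_iff)
qed

lemma prod_uminus_inverse_powers:
  fixes p :: "'a::field"
  assumes "k > 0"
  shows "(\<Prod>l=1..<k. - 1 / p ^ l) = (-1) ^ (k - 1) / p ^ (k choose 2)"
  using assms
proof (induction k rule: nat_induct_non_zero)
  case (Suc k)
  then obtain k' where k: "k = Suc k'" by (cases k) auto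
  have "(\<Prod>l=1..<Suc k. - 1 / p ^ l) = (\<Prod>l=1..<k. - 1 / p ^ l) * (- 1 / p ^ k)"
    using Suc by simp
  thus ?case unfolding Suc.IH Suc_choose_2 by (simp add: k power_add)
qed (simp add: binomial_eq_0)

text \<open>The left side is what [n-j, j] leaves when q^(n-s) is replaced by q^(-s). Its numerator
  is that of [2j, j] shifted down by one, so the two differ only in their end factors.\<close>

lemma qbinom_shift_central:
  fixes q :: "'a::field"
  assumes q: "\<forall>i>0. q ^ i \<noteq> 1" and "j > 0"
  shows "(\<Prod>i=1..j. (1 - q ^ (j + i - 1)) / (1 - q ^ i)) =
         qbinom q (int (2 * j)) (int j) * (1 - q ^ j) / (1 - q ^ (2 * j))"
proof -
  have "(\<Prod>i=1..j. 1 - q ^ (j + i - 1)) * (1 - q ^ (2 * j)) = (\<Prod>i=1..Suc j. 1 - q ^ (j + i - 1))"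
    by (simp add: mult_2)
  also have "\<dots> = (1 - q ^ j) * (\<Prod>i=Suc 1..Suc j. 1 - q ^ (j + i - 1))"
    by (subst prod.atLeast_Suc_atMost) simp_all
  also have "(\<Prod>i=Suc 1..Suc j. 1 - q ^ (j + i - 1)) = (\<Prod>i=1..j. 1 - q ^ (j + i))"
    unfolding prod.shift_bounds_cl_Suc_ivl by simp
  finally have "(\<Prod>i=1..j. 1 - q ^ (j + i - 1)) = (1 - q ^ j) * (\<Prod>i=1..j. 1 - q ^ (j + i)) / (1 - q ^ (2 * j))"
    using assms by (simp add: field_simps)
  thus ?thesis unfolding mult_2 qbinom_conv_prod_rev prod_dividef by (simp add: mult_ac)
qed

text \<open>Both sides are the q-multinomial coefficient with parts h, h and ch. It trades the lower
  index 2h, where two denominator factors degenerate if p has order h, for the lower index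
  h.\<close>

lemma qbinom_mult_qbinom_double:
  fixes p :: "'a::field"
  assumes p: "\<forall>i>0. p ^ i \<noteq> 1"
  shows "qbinom p (int ((c + 2) * h)) (int (2 * h)) * qbinom p (int (2 * h)) (int h) =
         qbinom p (int ((c + 2) * h)) (int h) * qbinom p (int ((c + 1) * h)) (int h)"
proof -
  let ?P = "\<lambda>m k. \<Prod>i=1..k. 1 - p ^ (m + i)"
  have split: "?P m (2 * h) = ?P m h * ?P (m + h) h" for m
  proof -
    have "?P m (2 * h) = ?P m h * (\<Prod>i=h+1..h+h. 1 - p ^ (m + i))"
      unfolding mult_2 by (rule prod.ub_add_nat) simp
    also have "(\<Prod>i=h+1..h+h. 1 - p ^ (m + i)) = ?P (m + h) h"
      using prod.shift_bounds_cl_nat_ivl[of "\<lambda>i. 1 - p ^ (m + i)" 1 h h]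
      by (simp add: add_ac)
    finally show ?thesis .
  qed
  have nz: "?P m h \<noteq> 0" for m using p by simp
  have q: "qbinom p (int (m + k)) (int k) = ?P m k / ?P 0 k" for m k
    unfolding qbinom_conv_prod_rev by (simp add: prod_dividef)
  have e: "(c + 2) * h = c * h + 2 * h" "(c + 2) * h = (c * h + h) + h" "(c + 1) * h = c * h + h"
    by (simp_all add: algebra_simps)
  have f: "qbinom p (int ((c + 2) * h)) (int (2 * h)) = ?P (c * h) (2 * h) / ?P 0 (2 * h)"
    "qbinom p (int ((c + 2) * h)) (int h) = ?P (c * h + h) h / ?P 0 h"
    "qbinom p (int ((c + 1) * h)) (int h) = ?P (c * h) h / ?P 0 h"
    "qbinom p (int (2 * h)) (int h) = ?P (0 + h) h / ?P 0 h"
    unfolding e(1) q using q[of "c * h + h" h] q[of "c * h" h] q[of h h]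
    by (simp_all add: algebra_simps)
  have *: "(x * y) / (z * w) * (w / z) = y / z * (x / z)" if "w \<noteq> 0" "z \<noteq> 0" for x y z w :: 'a
    using that by simp
  show ?thesis unfolding f split by (rule *[OF nz nz])
qed

section \<open>Localization at the cyclotomic polynomial\<close>

abbreviation complex_poly :: "int poly \<Rightarrow> complex poly" where
  "complex_poly \<equiv> map_poly of_int"

lemma complex_poly_mult: "complex_poly (a * b) = complex_poly a * complex_poly b"
  by (rule poly_eqI) (simp add: coeff_map_poly coeff_mult)

lemma complex_poly_power: "complex_poly (a ^ k) = complex_poly a ^ k"
  by (induction k) (simp_all add: complex_poly_mult)

lemma complex_poly_prod: "complex_poly (\<Prod>d\<in>A. h d) = (\<Prod>d\<in>A. complex_poly (h d))"
  by (induction A rule: infinite_finite_induct) (simp_all add: complex_poly_mult)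

lemma complex_poly_eq_iff: "complex_poly a = complex_poly b \<longleftrightarrow> a = b"
  by (simp add: poly_eq_iff coeff_map_poly)

lemma degree_complex_poly: "degree (complex_poly a) = degree a"
  by (simp add: degree_map_poly)

lemma lead_coeff_cyclotomic:
  assumes "n > 0"
  shows "lead_coeff (cyclotomic n) = 1"
proof -
  have "of_int (lead_coeff (cyclotomic n)) = lead_coeff (complex_poly (cyclotomic n))"
    by (simp add: degree_complex_poly coeff_map_poly)
  also have "\<dots> = 1"
    unfolding map_poly_cyclotomic[OF assms] by (simp add: lead_coeff_prod)
  finally show ?thesis by simp
qed

lemma cyclotomic_dvd:
  assumes "n > 0"
  shows "cyclotomic n dvd monom 1 n - 1"
proof -
  have "complex_poly (\<Prod>d | d dvd n. cyclotomic d) = (\<Prod>d | d dvd n. \<Prod>z\<in>primitive_roots d. [:- z, 1:])"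
    unfolding complex_poly_prod
    by (rule prod.cong) (use assms in \<open>auto intro!: map_poly_cyclotomic dest: dvd_pos_nat[rotated]\<close>)
  also have "\<dots> = complex_poly (monom 1 n - 1)"
    unfolding prod_primitive_roots[OF assms] by (rule poly_eqI) (simp add: coeff_map_poly)
  finally have "(\<Prod>d | d dvd n. cyclotomic d) = monom 1 n - 1"
    by (simp only: complex_poly_eq_iff)
  moreover have "cyclotomic n dvd (\<Prod>d | d dvd n. cyclotomic d)"
    using assms by (intro dvd_prodI) auto
  ultimately show ?thesis by simp
qed

lemma primitive_root_power_eq_1_iff:
  assumes "n > 0" "z \<in> primitive_roots n"
  shows "z ^ i = 1 \<longleftrightarrow> n dvd i"
proof
  assume i: "z ^ i = 1"
  have "z ^ i = z ^ (n * (i div n) + i mod n)" by simp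
  also have "\<dots> = z ^ (i mod n)"
    using assms(2) by (simp only: power_add power_mult primitive_roots_def) simp
  finally have "z ^ (i mod n) = 1" using i by simp
  moreover have "i mod n < n" using assms(1) by simp
  ultimately show "n dvd i" using assms(2) by (auto simp: primitive_roots_def dvd_eq_mod_eq_0)
next
  assume "n dvd i"
  thus "z ^ i = 1" using assms(2) by (auto simp: primitive_roots_def power_mult)
qed

locale cyclotomic_localization =
  fixes n :: nat
  assumes n_pos: "n > 0"
begin

text \<open>Nonvanishing at the roots is visibly multiplicative and can be tested on
  \<open>1 - q ^ i\<close> by evaluation; coprimality to Phi_n is derived from it.\<close>

definition regular :: "int poly \<Rightarrow> bool" where
  "regular b \<longleftrightarrow> b \<noteq> 0 \<and> (\<forall>z\<in>primitive_roots n. poly (complex_poly b) z \<noteq> 0)"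

text \<open>Membership in the \<open>e\<close>-th power of the ideal generated by the cyclotomic polynomial in the
  subring of the fractions whose denominators do not vanish at any primitive root of unity.\<close>

definition I :: "nat \<Rightarrow> int poly fract \<Rightarrow> bool" where
  "I e f \<longleftrightarrow> (\<exists>a b. regular b \<and> f = Fract (cyclotomic n ^ e * a) b)"

text \<open>The conjunct \<open>f \<noteq> 0\<close> excludes 0, which would otherwise qualify
  because of the convention \<open>inverse 0 = 0\<close>.\<close>

definition unit :: "int poly fract \<Rightarrow> bool" where
  "unit f \<longleftrightarrow> f \<noteq> 0 \<and> I 0 f \<and> I 0 (inverse f)"

text \<open>Membership of both sides in the localized ring is part of the relation, so that
  congruences can be multiplied.\<close>

definition cong :: "nat \<Rightarrow> int poly fract \<Rightarrow> int poly fract \<Rightarrow> bool" where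
  "cong e f g \<longleftrightarrow> I 0 f \<and> I 0 g \<and> I e (f - g)"

lemma regular_1: "regular 1"
  by (simp add: regular_def)

lemma regular_mult: "regular a \<Longrightarrow> regular b \<Longrightarrow> regular (a * b)"
  by (simp add: regular_def complex_poly_mult)

text \<open>A common divisor of positive degree would have a complex root, which is then a primitive
  root of unity at which \<open>b\<close> vanishes.\<close>

lemma regular_imp_coprime:
  assumes "regular b"
  shows "coprime b (cyclotomic n ^ e)"
proof (rule coprimeI)
  fix d assume d: "d dvd b" "d dvd cyclotomic n ^ e"
  then obtain x y where xy: "b = d * x" "cyclotomic n ^ e = d * y" by (auto elim!: dvdE)
  have "degree d = 0"
  proof (rule ccontr)
    assume "degree d \<noteq> 0"
    hence "\<not> constant (poly (complex_poly d))"
      by (simp add: constant_degree degree_complex_poly)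
    then obtain z where z: "poly (complex_poly d) z = 0"
      using fundamental_theorem_of_algebra by blast
    have "poly (complex_poly (cyclotomic n ^ e)) z = 0"
      unfolding xy(2) complex_poly_mult using z by simp
    hence "poly (\<Prod>z\<in>primitive_roots n. [:- z, 1:]) z = 0"
      by (simp add: complex_poly_power map_poly_cyclotomic[OF n_pos])
    hence "z \<in> primitive_roots n"
      using finite_primitive_roots[OF n_pos] by (auto simp: poly_prod)
    moreover have "poly (complex_poly b) z = 0"
      unfolding xy(1) complex_poly_mult using z by simp
    ultimately show False using assms by (simp add: regular_def)
  qed
  then obtain c where c: "d = [:c:]" by (rule degree_eq_zeroE)
  \<comment> \<open>Coprimality over the integers also concerns constant divisors; these must divide
    the leading coefficient 1 of the power of Phi_n.\<close>
  have "lead_coeff d * lead_coeff y = 1"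
    unfolding lead_coeff_mult[symmetric] xy(2)[symmetric] lead_coeff_power
    by (simp add: lead_coeff_cyclotomic n_pos)
  hence "c * lead_coeff y = 1" unfolding c by simp
  hence "c dvd 1" by (metis dvd_triv_left)
  thus "is_unit d" unfolding c by (simp add: is_unit_const_poly_iff)
qed

lemma I_imp_ratfun_cong:
  assumes "I e (f - g)"
  shows "ratfun_cong f g (cyclotomic n ^ e)"
  using assms regular_imp_coprime unfolding I_def ratfun_cong_def regular_def
  by (metis dvd_triv_left)

lemma I_mult: "I d f \<Longrightarrow> I e g \<Longrightarrow> I (d + e) (f * g)"
proof -
  assume "I d f" "I e g"
  then obtain a b a' b' where "regular b" "f = Fract (cyclotomic n ^ d * a) b"
    "regular b'" "g = Fract (cyclotomic n ^ e * a') b'"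
    by (auto simp: I_def)
  hence "regular (b * b')" "f * g = Fract (cyclotomic n ^ (d + e) * (a * a')) (b * b')"
    by (simp_all add: regular_mult power_add algebra_simps)
  thus ?thesis unfolding I_def by blast
qed

lemma I_add: "I e f \<Longrightarrow> I e g \<Longrightarrow> I e (f + g)"
proof -
  assume "I e f" "I e g"
  then obtain a b a' b' where r: "regular b" "regular b'" and
    "f = Fract (cyclotomic n ^ e * a) b" "g = Fract (cyclotomic n ^ e * a') b'"
    by (auto simp: I_def)
  moreover have "b \<noteq> 0" "b' \<noteq> 0" using r by (auto simp: regular_def)
  ultimately have "regular (b * b')" "f + g = Fract (cyclotomic n ^ e * (a * b' + a' * b)) (b * b')"
    by (simp_all add: regular_mult algebra_simps)
  thus ?thesis unfolding I_def by blast
qed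

lemma I_Fract: "regular b \<Longrightarrow> I 0 (Fract a b)"
  unfolding I_def by (metis mult_1 power_0)

lemma I_to_fract: "I 0 (to_fract a)"
  unfolding to_fract_def by (rule I_Fract[OF regular_1])

lemma I_mono: "I e f \<Longrightarrow> d \<le> e \<Longrightarrow> I d f"
  unfolding I_def by (metis le_add_diff_inverse mult.assoc power_add)

lemma I_imp_I0: "I e f \<Longrightarrow> I 0 f"
  by (erule I_mono) simp

lemma I_mult_right: "I e f \<Longrightarrow> I 0 g \<Longrightarrow> I e (f * g)"
  using I_mult[of e f 0 g] by simp

lemma I_mult_left: "I 0 f \<Longrightarrow> I e g \<Longrightarrow> I e (f * g)"
  using I_mult[of 0 f e g] by simp

lemma I_mult_1_1: "I 1 f \<Longrightarrow> I 1 g \<Longrightarrow> I 2 (f * g)"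
  using I_mult[of 1 f 1 g] by (simp only: one_add_one)

lemma I_0: "I e 0"
  unfolding I_def by (intro exI[of _ 0] exI[of _ 1]) (simp add: regular_1 Zero_fract_def)

lemma I0_1: "I 0 1"
  using I_to_fract[of 1] by simp

lemma I0_of_nat: "I 0 (of_nat k)"
  unfolding of_nat_fract by (rule I_Fract[OF regular_1])

lemma I0_numeral: "I 0 (numeral k)"
  using I0_of_nat[of "numeral k"] by simp

lemma I0_qvar: "I 0 qvar"
  unfolding qvar_def by (rule I_to_fract)

lemma I_uminus: "I e f \<Longrightarrow> I e (- f)"
  using I_mult_left[of "to_fract (- 1)" e f] I_to_fract[of "- 1"] by simp

lemma I_diff: "I e f \<Longrightarrow> I e g \<Longrightarrow> I e (f - g)"
  using I_add[of e f "- g"] I_uminus by simp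

lemma I_sum: "(\<And>x. x \<in> A \<Longrightarrow> I e (f x)) \<Longrightarrow> I e (\<Sum>x\<in>A. f x)"
  by (induction A rule: infinite_finite_induct) (auto intro: I_0 I_add)

lemma I0_mult: "I 0 f \<Longrightarrow> I 0 g \<Longrightarrow> I 0 (f * g)"
  using I_mult[of 0 f 0 g] by simp

lemma I0_power: "I 0 f \<Longrightarrow> I 0 (f ^ k)"
  by (induction k) (auto intro: I0_1 I0_mult)

lemma I0_prod: "(\<And>x. x \<in> A \<Longrightarrow> I 0 (f x)) \<Longrightarrow> I 0 (\<Prod>x\<in>A. f x)"
  by (induction A rule: infinite_finite_induct) (auto intro: I0_1 I0_mult)

lemma unit_imp_I0: "unit f \<Longrightarrow> I 0 f"
  and unit_imp_nonzero: "unit f \<Longrightarrow> f \<noteq> 0"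
  by (auto simp: unit_def)

lemma I_divide: "I e f \<Longrightarrow> unit g \<Longrightarrow> I e (f / g)"
  unfolding divide_inverse unit_def by (auto intro: I_mult_right)

lemma unit_mult: "unit f \<Longrightarrow> unit g \<Longrightarrow> unit (f * g)"
  by (auto simp: unit_def intro: I0_mult)

lemma unit_divide: "unit f \<Longrightarrow> unit g \<Longrightarrow> unit (f / g)"
  by (auto simp: unit_def divide_inverse intro: I0_mult)

lemma unit_power: "unit f \<Longrightarrow> unit (f ^ k)"
  by (auto simp: unit_def power_inverse[symmetric] intro: I0_power)

lemma unit_to_fract: "regular a \<Longrightarrow> unit (to_fract a)"
  unfolding unit_def by (auto simp: I_to_fract) (auto simp: to_fract_def I_Fract regular_def)

lemma unit_of_nat:
  assumes "k > 0"
  shows "unit (of_nat k)"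
proof -
  have "complex_poly (of_nat k) = of_nat k" 
    by (simp add: of_nat_poly map_poly_pCons)
  hence "regular (of_nat k)" using assms by (simp add: regular_def)
  thus ?thesis using unit_to_fract[of "of_nat k"] by (simp add: of_nat_fract to_fract_def)
qed

lemma unit_numeral: "unit (numeral k)"
  using unit_of_nat[of "numeral k"] by simp

lemma unit_uminus: "unit f \<Longrightarrow> unit (- f)"
  by (auto simp: unit_def intro: I_uminus)

lemma unit_1: "unit 1"
  using unit_of_nat[of 1] by simp

text \<open>Adding a multiple of Phi_n to the numerator of a unit does not change its values at the
  primitive roots, so it stays regular.\<close>

lemma unit_near_unit:
  assumes "f \<noteq> 0" "I 1 (f - g)" "unit g"
  shows "unit f"
proof -
  have "I 1 ((f - g) / g)" using assms by (intro I_divide)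
  then obtain a b where b: "regular b" and ab: "(f - g) / g = Fract (cyclotomic n ^ 1 * a) b"
    by (auto simp: I_def)
  have "b \<noteq> 0" using b by (simp add: regular_def)
  have "f / g = 1 + (f - g) / g"
    using unit_imp_nonzero[OF assms(3)] by (simp add: field_simps)
  also have "\<dots> = Fract (b + cyclotomic n * a) b"
    unfolding ab One_fract_def using \<open>b \<noteq> 0\<close> by simp
  finally have fg: "f / g = Fract (b + cyclotomic n * a) b" .
  have "b + cyclotomic n * a \<noteq> 0"
    using fg assms(1) unit_imp_nonzero[OF assms(3)] \<open>b \<noteq> 0\<close>
    by (metis divide_eq_0_iff fract_collapse(1))
  moreover have "poly (complex_poly (b + cyclotomic n * a)) z = poly (complex_poly b) z"
    if "z \<in> primitive_roots n" for z
  proof -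
    have "complex_poly (b + cyclotomic n * a) = complex_poly b + complex_poly (cyclotomic n) * complex_poly a"
      unfolding complex_poly_mult[symmetric] by (rule poly_eqI) (simp add: coeff_map_poly)
    moreover have "poly (complex_poly (cyclotomic n)) z = 0"
      unfolding map_poly_cyclotomic[OF n_pos] poly_prod
      using that finite_primitive_roots[OF n_pos] by (intro prod_zero) auto
    ultimately show ?thesis by simp
  qed
  ultimately have "regular (b + cyclotomic n * a)" using b by (auto simp: regular_def)
  hence "I 0 (inverse (f / g))" unfolding fg by (simp add: I_Fract)
  moreover have "I 0 (f / g)" unfolding fg using b by (rule I_Fract)
  ultimately have "unit (f / g)"
    using assms(1) unit_imp_nonzero[OF assms(3)] by (simp add: unit_def)
  hence "unit (f / g * g)" using assms(3) by (rule unit_mult)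
  thus ?thesis using unit_imp_nonzero[OF assms(3)] by simp
qed

lemma unit_qvar: "unit qvar"
  unfolding qvar_def
proof (rule unit_to_fract)
  have "0 \<notin> primitive_roots n" using n_pos by (simp add: primitive_roots_def zero_power)
  thus "regular [:0, 1:]" by (auto simp: regular_def map_poly_pCons)
qed

lemma qvar_power: "qvar ^ i = to_fract (monom 1 i)"
proof (induction i)
  case (Suc i)
  have "monom (1::int) (Suc i) = [:0, 1:] * monom 1 i" by (simp add: monom_Suc)
  thus ?case by (simp only: power_Suc Suc to_fract_mult qvar_def[symmetric])
qed (simp add: monom_0 flip: one_pCons)

lemma unit_1_minus_qvar_power:
  assumes "\<not> n dvd i"
  shows "unit (1 - qvar ^ i)"
proof -
  have *: "complex_poly (1 - monom 1 i) = 1 - monom 1 i"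
    by (rule poly_eqI) (simp add: coeff_map_poly)
  have "1 - monom (1::int) i \<noteq> 0"
    using assms by (metis monom_eq_1_iff dvd_0_right right_minus_eq)
  hence "regular (1 - monom 1 i)"
    using assms primitive_root_power_eq_1_iff[OF n_pos]
    by (auto simp: regular_def * poly_monom)
  thus ?thesis using unit_to_fract[of "1 - monom 1 i"] by (simp add: qvar_power)
qed

lemma I_1_minus_qvar_power_n: "I 1 (1 - qvar ^ n)"
proof -
  obtain a where "monom 1 n - 1 = cyclotomic n * a"
    using cyclotomic_dvd[OF n_pos] by (rule dvdE)
  hence "1 - monom 1 n = cyclotomic n ^ 1 * (- a)" by (simp add: algebra_simps)
  hence "1 - qvar ^ n = Fract (cyclotomic n ^ 1 * (- a)) 1"
    unfolding qvar_power to_fract_def[symmetric] by (metis to_fract_1 to_fract_diff)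
  thus ?thesis unfolding I_def using regular_1 by blast
qed

section \<open>Calculus of congruences\<close>

lemma cong_refl: "I 0 f \<Longrightarrow> cong e f f"
  by (simp add: cong_def I_0)

lemma cong_sym: "cong e f g \<Longrightarrow> cong e g f"
  unfolding cong_def using I_uminus[of e "f - g"] by simp

lemma cong_trans [trans]: "cong e f g \<Longrightarrow> cong e g h \<Longrightarrow> cong e f h"
  unfolding cong_def using I_add[of e "f - g" "g - h"] by simp

lemma cong_add: "cong e f g \<Longrightarrow> cong e f' g' \<Longrightarrow> cong e (f + f') (g + g')"
  unfolding cong_def using I_add[of e "f - g" "f' - g'"] by (auto intro: I_add simp: algebra_simps)

lemma cong_diff: "cong e f g \<Longrightarrow> cong e f' g' \<Longrightarrow> cong e (f - f') (g - g')"
  unfolding cong_def using I_diff[of e "f - g" "f' - g'"] by (auto intro: I_diff simp: algebra_simps)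

lemma cong_mult:
  assumes "cong e f g" "cong e f' g'"
  shows "cong e (f * f') (g * g')"
proof -
  have "f * f' - g * g' = (f - g) * f' + g * (f' - g')" by (simp add: algebra_simps)
  thus ?thesis using assms unfolding cong_def by (auto intro: I_add I_mult_left I_mult_right I0_mult)
qed

text \<open>The device that lowers precision: next to a factor divisible by Phi_n, the cofactor need
  only be known modulo Phi_n.\<close>

lemma cong_mult_I1:
  assumes "I 1 h" "cong 1 f g"
  shows "cong 2 (h * f) (h * g)"
  using assms I_mult_1_1[of h "f - g"] I_imp_I0[OF assms(1)]
  unfolding cong_def by (auto intro: I0_mult simp: algebra_simps)

lemma cong_divide:
  assumes "cong e f g" "cong e f' g'" "unit f'" "unit g'"
  shows "cong e (f / f') (g / g')"
proof -
  have "inverse f' - inverse g' = (g' - f') / (f' * g')"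
    using assms(3,4) by (simp add: unit_def field_simps)
  hence "cong e (inverse f') (inverse g')"
    using assms cong_sym[OF assms(2)] unfolding cong_def
    by (auto intro: I_divide unit_mult) (auto simp: unit_def)
  thus ?thesis unfolding divide_inverse using assms(1) by (intro cong_mult)
qed

lemma cong_power: "cong e f g \<Longrightarrow> cong e (f ^ k) (g ^ k)"
  by (induction k) (auto intro: cong_mult cong_refl I0_1)

lemma cong_sum: "(\<And>x. x \<in> A \<Longrightarrow> cong e (f x) (g x)) \<Longrightarrow> cong e (\<Sum>x\<in>A. f x) (\<Sum>x\<in>A. g x)"
  by (induction A rule: infinite_finite_induct) (auto intro: cong_add cong_refl I_0)

lemma cong_prod: "(\<And>x. x \<in> A \<Longrightarrow> cong e (f x) (g x)) \<Longrightarrow> cong e (\<Prod>x\<in>A. f x) (\<Prod>x\<in>A. g x)"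
  by (induction A rule: infinite_finite_induct) (auto intro: cong_mult cong_refl I0_1)

lemma cong_mono: "cong e f g \<Longrightarrow> d \<le> e \<Longrightarrow> cong d f g"
  unfolding cong_def by (auto intro: I_mono)

lemma cong_0_iff: "cong e f 0 \<longleftrightarrow> I e f"
  unfolding cong_def using I_0 I_imp_I0 by auto

lemma congI: "I e (f - g) \<Longrightarrow> I 0 g \<Longrightarrow> cong e f g"
  unfolding cong_def using I_add[of 0 "f - g" g] I_imp_I0[of e "f - g"] by simp

lemmas I0_intros = I_add I_diff I_uminus I0_mult I0_power I0_prod I_sum I0_1 I_0 I0_of_nat
  I0_numeral I0_qvar I_divide

section \<open>Congruences modulo the square of the cyclotomic polynomial\<close>

lemma qvar_nonzero: "qvar \<noteq> 0"
  using unit_qvar by (rule unit_imp_nonzero)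

lemma qvar_power_neq_1: "\<forall>i>0. qvar ^ i \<noteq> 1"
  unfolding qvar_power
  by (metis monom_eq_1_iff not_gr0 to_fract_1 to_fract_eq_iff)

lemma I_1_minus_power:
  assumes "I 1 (1 - P)"
  shows "I 1 (1 - P ^ k)"
proof -
  have "I 0 P" using I_diff[OF I0_1 I_imp_I0[OF assms]] by simp
  hence "I 1 ((1 - P) * (\<Sum>i<k. P ^ i))" using assms by (intro I_mult_right I_sum I0_power)
  thus ?thesis by (simp add: one_diff_power_eq)
qed

lemma I_1_minus_qvar_power:
  assumes "n dvd i"
  shows "I 1 (1 - qvar ^ i)"
  using assms I_1_minus_power[OF I_1_minus_qvar_power_n] by (auto simp: power_mult elim!: dvdE)

lemma qvar_power_cong:
  assumes "a mod n = b mod n"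
  shows "cong 1 (qvar ^ a) (qvar ^ b)"
proof -
  have *: "cong 1 (qvar ^ a) (qvar ^ (a mod n))" for a
  proof -
    have "qvar ^ a = qvar ^ (n * (a div n)) * qvar ^ (a mod n)"
      by (simp flip: power_add)
    hence "qvar ^ a - qvar ^ (a mod n) = - (1 - qvar ^ (n * (a div n))) * qvar ^ (a mod n)"
      by (simp add: algebra_simps)
    moreover have "I 1 (- (1 - qvar ^ (n * (a div n))) * qvar ^ (a mod n))"
      by (intro I_mult_right I_uminus I_1_minus_qvar_power I0_power I0_qvar) simp
    ultimately show ?thesis by (intro congI I0_power I0_qvar) simp
  qed
  show ?thesis using cong_trans[OF *[of a]] cong_sym[OF *[of b]] assms by simp
qed

lemma qvar_power_cong_1: "n dvd i \<Longrightarrow> cong 1 (qvar ^ i) 1"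
  using qvar_power_cong[of i 0] by simp

section \<open>First-order expansions\<close>

lemma power_cong_linear:
  assumes P: "I 1 (1 - P)"
  shows "cong 2 (P ^ k) (1 - of_nat k * (1 - P))"
proof (induction k)
  case 0
  show ?case by (simp add: cong_refl I0_1)
next
  case (Suc k)
  have P0: "I 0 P" using I_diff[OF I0_1 I_imp_I0[OF P]] by simp
  have "cong 2 (P ^ Suc k) (P * (1 - of_nat k * (1 - P)))"
    unfolding power_Suc by (intro cong_mult cong_refl P0 Suc)
  also have "cong 2 \<dots> (1 - of_nat (Suc k) * (1 - P))"
  proof (rule congI)
    have "I 2 ((of_nat k * (1 - P)) * (1 - P))"
      by (intro I_mult_1_1 I_mult_left P I0_of_nat)
    thus "I 2 (P * (1 - of_nat k * (1 - P)) - (1 - of_nat (Suc k) * (1 - P)))"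
      by (simp add: algebra_simps)
  qed (intro I0_intros P0)
  finally show ?case .
qed

lemma one_minus_power_cong:
  assumes P: "I 1 (1 - P)"
  shows "cong 2 (1 - P ^ k) (of_nat k * (1 - P))"
  using cong_diff[OF cong_refl[OF I0_1] power_cong_linear[OF P, of k]] by simp

lemma geometric_sum_cong:
  assumes P: "I 1 (1 - P)"
  shows "cong 2 (\<Sum>i<a. P ^ i) (of_nat a - of_nat a * (of_nat a - 1) / 2 * (1 - P))"
proof (induction a)
  case 0
  show ?case by (simp add: cong_refl I_0)
next
  case (Suc a)
  have "cong 2 (\<Sum>i<Suc a. P ^ i)
    ((of_nat a - of_nat a * (of_nat a - 1) / 2 * (1 - P)) + (1 - of_nat a * (1 - P)))"
    unfolding sum.lessThan_Suc by (intro cong_add Suc power_cong_linear P)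
  also have "\<dots> = of_nat (Suc a) - of_nat (Suc a) * (of_nat (Suc a) - 1) / 2 * (1 - P)"
    by (simp add: field_simps)
  finally show ?case .
qed

lemma prod_cong_linear:
  assumes "I 1 d" "\<And>x. x \<in> A \<Longrightarrow> I 0 (u x)"
  shows "cong 2 (\<Prod>x\<in>A. 1 + d * u x) (1 + d * (\<Sum>x\<in>A. u x))"
  using assms(2)
proof (induction A rule: infinite_finite_induct)
  case (insert x A)
  have u: "I 0 (u x)" and s: "I 0 (\<Sum>x\<in>A. u x)" using insert by (auto intro: I_sum)
  note d0 = I_imp_I0[OF assms(1)]
  have "cong 2 (\<Prod>x\<in>insert x A. 1 + d * u x) ((1 + d * u x) * (1 + d * (\<Sum>x\<in>A. u x)))"
    using insert by (auto intro!: cong_mult cong_refl I0_intros d0 u)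
  also have "cong 2 \<dots> (1 + d * (\<Sum>x\<in>insert x A. u x))"
  proof (rule congI)
    have "I 2 ((d * u x) * (d * (\<Sum>x\<in>A. u x)))"
      by (intro I_mult_1_1 I_mult_right assms(1) u s)
    thus "I 2 ((1 + d * u x) * (1 + d * (\<Sum>x\<in>A. u x)) - (1 + d * (\<Sum>x\<in>insert x A. u x)))"
      using insert by (simp add: algebra_simps)
  next
    show "I 0 (1 + d * (\<Sum>x\<in>insert x A. u x))"
      using insert by (auto intro!: I0_intros d0 u s)
  qed
  finally show ?case .
qed (auto intro: cong_refl I0_1)

text \<open>The summands for \<open>i\<close> and \<open>h - i\<close> add up to \<open>- 1\<close>.\<close>

lemma half_sum_cong:
  assumes u: "\<And>i. 0 < i \<Longrightarrow> i < h \<Longrightarrow> unit (1 - p ^ i)" and p: "unit p" and ph: "I 1 (1 - p ^ h)"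
    and "h > 0"
  shows "cong 1 (\<Sum>i=1..<h. p ^ i / (1 - p ^ i)) (- (of_nat h - 1) / 2)"
proof (rule congI)
  let ?S = "\<Sum>i=1..<h. p ^ i / (1 - p ^ i)"
  have S: "?S = (\<Sum>i=1..<h. p ^ (h - i) / (1 - p ^ (h - i)))"
    by (rule sum.reindex_bij_witness[of _ "\<lambda>i. h - i" "\<lambda>i. h - i"]) auto
  have "p ^ i / (1 - p ^ i) + p ^ (h - i) / (1 - p ^ (h - i)) + 1
      = (1 - p ^ h) / ((1 - p ^ i) * (1 - p ^ (h - i)))" if "i \<in> {1..<h}" for i
  proof -
    have *: "x / (1 - x) + y / (1 - y) + 1 = (1 - x * y) / ((1 - x) * (1 - y))"
      if "1 - x \<noteq> 0" "1 - y \<noteq> 0" for x y :: "int poly fract"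
      using that by (simp add: divide_simps) (simp add: algebra_simps)
    have "p ^ h = p ^ i * p ^ (h - i)" using that by (simp flip: power_add)
    thus ?thesis using *[of "p ^ i" "p ^ (h - i)"] that u[of i] u[of "h - i"]
      by (simp only: unit_imp_nonzero) (simp add: unit_def)
  qed
  hence "(\<Sum>i=1..<h. p ^ i / (1 - p ^ i) + p ^ (h - i) / (1 - p ^ (h - i)) + 1)
      = (\<Sum>i=1..<h. (1 - p ^ h) / ((1 - p ^ i) * (1 - p ^ (h - i))))" by simp
  moreover have "I 1 \<dots>" by (intro I_sum I_divide ph unit_mult u) auto
  moreover have "(\<Sum>i=1..<h. p ^ i / (1 - p ^ i) + p ^ (h - i) / (1 - p ^ (h - i)) + 1)
      = 2 * ?S + (of_nat h - 1)"
    unfolding sum.distrib S[symmetric] using assms(4) by (simp add: of_nat_diff)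
  ultimately have "I 1 (2 * ?S + (of_nat h - 1))" by simp
  hence "I 1 ((2 * ?S + (of_nat h - 1)) / 2)" by (intro I_divide unit_numeral)
  also have "(2 * ?S + (of_nat h - 1)) / 2 = ?S - - (of_nat h - 1) / 2" by (simp add: field_simps)
  finally show "I 1 (?S - - (of_nat h - 1) / 2)" .
qed (intro I0_intros unit_numeral)

text \<open>Base and order stay open to cover q with h = n, q^2 with h = n for odd n, and q^2 with h
  = n/2 for even n. Of the coefficient -h*a(a-1)/2, the factors i < h contribute -(h-1)*a(a-1)/2 and
  the factor i = h the rest.\<close>

lemma qbinom_multiple_cong:
  assumes u: "\<And>i. 0 < i \<Longrightarrow> i < h \<Longrightarrow> unit (1 - p ^ i)" and p: "unit p" and ph: "I 1 (1 - p ^ h)"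
    and "h > 0" and p1: "p ^ h \<noteq> 1" and "a > 0"
  shows "cong 2 (qbinom p (int (a * h)) (int h))
           (of_nat a - of_nat h * (of_nat a * (of_nat a - 1) / 2) * (1 - p ^ h))"
proof -
  obtain c where a: "a = Suc c" using assms(6) by (cases a) auto
  define P where "P = p ^ h"
  define S where "S = (\<Sum>i=1..<h. p ^ i / (1 - p ^ i))"
  have P: "I 1 (1 - P)" using ph by (simp add: P_def)
  have P0: "I 0 (1 - P)" using P by (rule I_imp_I0)
  have S0: "I 0 S" unfolding S_def using u
    by (auto intro!: I_sum I_divide I0_power unit_imp_I0[OF p])
  have "qbinom p (int (a * h)) (int h) = (\<Prod>i=1..h. (1 - p ^ (c * h + i)) / (1 - p ^ i))"
    using qbinom_conv_prod_rev[of p "c * h" h] by (simp add: a add.commute)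
  also have "\<dots> = (\<Prod>i=1..<h. (1 - p ^ (c * h + i)) / (1 - p ^ i)) * ((1 - P ^ a) / (1 - P))"
    using assms(4) unfolding a P_def
    by (cases h) (simp_all add: atLeastLessThanSuc_atLeastAtMost power_mult[symmetric] mult.commute
         del: power_Suc, simp add: algebra_simps)
  also have "(\<Prod>i=1..<h. (1 - p ^ (c * h + i)) / (1 - p ^ i))
      = (\<Prod>i=1..<h. 1 + (1 - P ^ c) * (p ^ i / (1 - p ^ i)))"
  proof (rule prod.cong)
    fix i assume i: "i \<in> {1..<h}"
    have "1 - p ^ i \<noteq> 0" using u[of i] i by (auto dest: unit_imp_nonzero)
    thus "(1 - p ^ (c * h + i)) / (1 - p ^ i) = 1 + (1 - P ^ c) * (p ^ i / (1 - p ^ i))"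
      by (simp add: field_simps power_add P_def power_mult[symmetric])
  qed simp
  \<comment> \<open>Numerator and denominator of the factor i = h are both divisible by Phi_n, so
    they must be cancelled before any reduction.\<close>
  also have "(1 - P ^ a) / (1 - P) = (\<Sum>i<a. P ^ i)"
    using p1 by (intro geometric_quotient) (simp add: P_def)
  finally have "qbinom p (int (a * h)) (int h) =
    (\<Prod>i=1..<h. 1 + (1 - P ^ c) * (p ^ i / (1 - p ^ i))) * (\<Sum>i<a. P ^ i)" .
  also have "cong 2 \<dots> ((1 + (1 - P ^ c) * S) * (of_nat a - of_nat a * (of_nat a - 1) / 2 * (1 - P)))"
    unfolding S_def
    by (intro cong_mult prod_cong_linear geometric_sum_cong P I_1_minus_power I_divide I0_power
          unit_imp_I0[OF p] u) auto
  also have "cong 2 \<dots> ((1 + of_nat c * (1 - P) * S) * (of_nat a - of_nat a * (of_nat a - 1) / 2 * (1 - P)))"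
    by (intro cong_mult cong_add one_minus_power_cong P cong_refl S0 I0_1 I0_intros unit_numeral P0)
  also have "cong 2 \<dots> ((1 + of_nat c * (1 - P) * (- (of_nat h - 1) / 2)) * (of_nat a - of_nat a * (of_nat a - 1) / 2 * (1 - P)))"
  proof -
    \<comment> \<open>\<open>S\<close> occurs only next to \<open>1 - P\<close>, so its value modulo
      Phi_n suffices.\<close>
    have *: "cong 2 (of_nat c * (1 - P) * S) (of_nat c * (1 - P) * (- (of_nat h - 1) / 2))"
      unfolding S_def by (intro cong_mult_I1 I_mult_left P I0_of_nat half_sum_cong u p ph assms(4))
    show ?thesis
      by (rule cong_mult[OF cong_add[OF cong_refl *] cong_refl]) (intro I0_intros unit_numeral P0)+
  qed
  also have "cong 2 \<dots> (of_nat a - of_nat h * (of_nat a * (of_nat a - 1) / 2) * (1 - P))"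
  proof (rule congI)
    have "I 2 ((of_nat c * (of_nat h - 1) / 2 * (of_nat a * (of_nat a - 1) / 2) * (1 - P)) * (1 - P))"
      by (intro I_mult_1_1 I_mult_left P I0_intros unit_numeral)
    also have "(of_nat c * (of_nat h - 1) / 2 * (of_nat a * (of_nat a - 1) / 2) * (1 - P)) * (1 - P) =
      (1 + of_nat c * (1 - P) * (- (of_nat h - 1) / 2)) * (of_nat a - of_nat a * (of_nat a - 1) / 2 * (1 - P))
        - (of_nat a - of_nat h * (of_nat a * (of_nat a - 1) / 2) * (1 - P))"
      unfolding a by (simp add: field_simps)
    finally show "I 2 ((1 + of_nat c * (1 - P) * (- (of_nat h - 1) / 2)) * (of_nat a - of_nat a * (of_nat a - 1) / 2 * (1 - P))
        - (of_nat a - of_nat h * (of_nat a * (of_nat a - 1) / 2) * (1 - P)))" .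
  qed (intro I0_intros unit_numeral P0)
  finally show ?thesis by (simp only: P_def)
qed

section \<open>Reflection of exponents and q-binomials of multiples of n\<close>

lemma qvar_sq_power: "(qvar\<^sup>2) ^ i = qvar ^ (2 * i)"
  by (simp add: power_mult)

text \<open>This is q^(N-s) = q^(-s) modulo Phi_n; the exact error is (1 - q^N)/q^s.\<close>

lemma one_minus_qvar_reflect:
  assumes "n dvd N" "s \<le> N"
  shows "cong 1 (1 - qvar ^ (N - s)) (- (1 - qvar ^ s) / qvar ^ s)"
proof (rule congI)
  have "qvar ^ N = qvar ^ (N - s) * qvar ^ s" using assms(2) by (simp flip: power_add)
  hence "(1 - qvar ^ (N - s)) - (- (1 - qvar ^ s) / qvar ^ s) = (1 - qvar ^ N) / qvar ^ s"
    using qvar_nonzero by (simp add: field_simps)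
  thus "I 1 ((1 - qvar ^ (N - s)) - (- (1 - qvar ^ s) / qvar ^ s))"
    using I_1_minus_qvar_power[OF assms(1)] by (simp only: I_divide unit_power unit_qvar)
qed (intro I0_intros unit_power unit_qvar)

lemma qvar_ratio_cong:
  assumes "n dvd N" "s \<le> N" "\<not> n dvd s"
  shows "cong 1 ((1 - qvar ^ (N - s)) / (1 - qvar ^ s)) (- 1 / qvar ^ s)"
proof -
  have u: "unit (1 - qvar ^ s)" using assms(3) by (rule unit_1_minus_qvar_power)
  have "cong 1 ((1 - qvar ^ (N - s)) / (1 - qvar ^ s)) ((- (1 - qvar ^ s) / qvar ^ s) / (1 - qvar ^ s))"
    by (intro cong_divide one_minus_qvar_reflect assms cong_refl unit_imp_I0 u)
  also have "(- (1 - qvar ^ s) / qvar ^ s) / (1 - qvar ^ s) = - 1 / qvar ^ s"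
    using unit_imp_nonzero[OF u] by (simp add: divide_simps)
  finally show ?thesis .
qed

lemma qbinom_n_cong:
  assumes "a > 0"
  shows "cong 2 (qbinom qvar (int (a * n)) (int n))
           (of_nat a - of_nat n * (of_nat a * (of_nat a - 1) / 2) * (1 - qvar ^ n))"
proof (rule qbinom_multiple_cong)
  show "unit (1 - qvar ^ i)" if "0 < i" "i < n" for i
    using that by (intro unit_1_minus_qvar_power) (auto dest: nat_dvd_not_less)
  show "qvar ^ n \<noteq> 1" using n_pos qvar_power_neq_1 by blast
qed (intro unit_qvar I_1_minus_qvar_power_n n_pos assms)+

lemma qbinom_half_cong:
  assumes "a > 0" "n = 2 * h"
  shows "cong 2 (qbinom (qvar\<^sup>2) (int (a * h)) (int h))
           (of_nat a - of_nat h * (of_nat a * (of_nat a - 1) / 2) * (1 - qvar ^ n))"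
proof -
  have "cong 2 (qbinom (qvar\<^sup>2) (int (a * h)) (int h))
           (of_nat a - of_nat h * (of_nat a * (of_nat a - 1) / 2) * (1 - (qvar\<^sup>2) ^ h))"
  proof (rule qbinom_multiple_cong)
    show "unit (1 - (qvar\<^sup>2) ^ i)" if "0 < i" "i < h" for i
      unfolding qvar_sq_power using that assms(2)
      by (intro unit_1_minus_qvar_power) (auto dest: nat_dvd_not_less)
    show "(qvar\<^sup>2) ^ h \<noteq> 1"
      using n_pos qvar_power_neq_1 by (simp add: qvar_sq_power assms(2))
    show "h > 0" using n_pos assms(2) by simp
    show "I 1 (1 - (qvar\<^sup>2) ^ h)"
      unfolding qvar_sq_power assms(2)[symmetric] by (rule I_1_minus_qvar_power_n)
  qed (intro unit_power unit_qvar assms)+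
  thus ?thesis by (simp only: qvar_sq_power assms(2))
qed

lemma qbinom_sq_n_cong_odd:
  assumes "m > 0" "odd n"
  shows "cong 2 (qbinom (qvar\<^sup>2) (int (m * n)) (int n))
           (of_nat m - of_nat n * of_nat m * (of_nat m - 1) * (1 - qvar ^ n))"
proof -
  have "coprime n 2" using assms(2) by simp
  have "cong 2 (qbinom (qvar\<^sup>2) (int (m * n)) (int n))
           (of_nat m - of_nat n * (of_nat m * (of_nat m - 1) / 2) * (1 - (qvar\<^sup>2) ^ n))"
  proof (rule qbinom_multiple_cong)
    show "unit (1 - (qvar\<^sup>2) ^ i)" if "0 < i" "i < n" for i
      unfolding qvar_sq_power using that \<open>coprime n 2\<close>
      by (intro unit_1_minus_qvar_power) (auto simp: coprime_dvd_mult_right_iff dest: nat_dvd_not_less)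
    show "(qvar\<^sup>2) ^ n \<noteq> 1"
      using n_pos qvar_power_neq_1 by (simp add: qvar_sq_power)
    show "I 1 (1 - (qvar\<^sup>2) ^ n)"
      unfolding qvar_sq_power by (rule I_1_minus_qvar_power) simp
  qed (intro unit_power unit_qvar assms n_pos)+
  \<comment> \<open>To first order 1 - q^(2n) is 2(1 - q^n), which cancels the denominator
    2.\<close>
  also have "cong 2 \<dots> (of_nat m - of_nat n * (of_nat m * (of_nat m - 1) / 2) * (of_nat 2 * (1 - qvar ^ n)))"
    unfolding power_mult[symmetric] mult.commute[of 2 n] unfolding power_mult
    by (intro cong_diff cong_mult one_minus_power_cong I_1_minus_qvar_power_n cong_refl I0_intros unit_numeral)
  also have "\<dots> = of_nat m - of_nat n * of_nat m * (of_nat m - 1) * (1 - qvar ^ n)"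
    by simp
  finally show ?thesis .
qed

text \<open>With n = 2h the base q^2 has order h < n, so \<open>qbinom_multiple_cong\<close> does
  not apply to the lower index n. Multiplication by [2h, h] turns the coefficient into a product of
  two with lower index h; the multiplier is congruent to 2 modulo Phi_n and can be
  cancelled.\<close>

lemma qbinom_sq_n_cong_even:
  assumes "m > 0" "even n"
  shows "cong 2 (qbinom (qvar\<^sup>2) (int (m * n)) (int n))
           ((2 * of_nat m - 1) * (of_nat m - of_nat n * of_nat m * (of_nat m - 1) * (1 - qvar ^ n)))"
proof -
  define d where "d = 1 - qvar ^ n"
  have d: "I 1 d" "I 0 d" unfolding d_def by (intro I_1_minus_qvar_power_n I_imp_I0[OF I_1_minus_qvar_power_n])+
  obtain h where h: "n = 2 * h" using assms(2) by (elim evenE)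
  obtain c where c: "m = Suc c" using assms(1) by (cases m) auto
  let ?g = "\<lambda>a. of_nat a - of_nat h * (of_nat a * (of_nat a - 1) / 2) * d"
  note I = I0_intros unit_numeral d
  have A: "m * n = (2 * c + 2) * h"
    unfolding c h by (simp add: algebra_simps)
  have p: "\<forall>i>0. (qvar\<^sup>2) ^ i \<noteq> 1"
    using qvar_power_neq_1 by (simp add: qvar_sq_power)
  let ?B = "qbinom (qvar\<^sup>2) (int (m * n)) (int n)"
  let ?R = "(2 * of_nat m - 1) * (of_nat m - of_nat n * of_nat m * (of_nat m - 1) * d)"
  let ?D = "qbinom (qvar\<^sup>2) (int (2 * h)) (int h)"
  have D: "cong 2 ?D (?g 2)" unfolding d_def by (rule qbinom_half_cong) (use h in auto)
  have "?B * ?D = qbinom (qvar\<^sup>2) (int ((2 * c + 2) * h)) (int h)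
      * qbinom (qvar\<^sup>2) (int ((2 * c + 1) * h)) (int h)"
    unfolding A unfolding h by (rule qbinom_mult_qbinom_double[OF p])
  also have "cong 2 \<dots> (?g (2 * c + 2) * ?g (2 * c + 1))"
    unfolding d_def by (intro cong_mult qbinom_half_cong h) simp_all
  also have "cong 2 \<dots> (?R * ?g 2)"
  proof (rule congI)
    let ?m = "of_nat m" and ?h = "of_nat h"
    have m: "of_nat c = (?m - 1 :: int poly fract)" unfolding c by simp
    have n: "of_nat n = (2 * ?h :: int poly fract)" unfolding h by simp
    \<comment> \<open>The cofactor of \<open>d * d\<close> is the quadratic coefficient of the
      difference; its constant and linear coefficients vanish.\<close>
    have "I 2 (d * (d * (?h * ?h * ?m * (2 * ?m - 1) * ((?m - 1) * (2 * ?m - 1) - 2 * (?m - 1)))))"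
      by (intro I_mult_1_1 I_mult_right I)
    also have "d * (d * (?h * ?h * ?m * (2 * ?m - 1) * ((?m - 1) * (2 * ?m - 1) - 2 * (?m - 1)))) = 
        ?g (2 * c + 2) * ?g (2 * c + 1) - ?R * ?g 2"
    proof -
      have g: "?g (2 * c + 2) = 2 * ?m - ?h * (?m * (2 * ?m - 1)) * d"
        "?g (2 * c + 1) = (2 * ?m - 1) - ?h * ((2 * ?m - 1) * (?m - 1)) * d"
        "?g 2 = 2 - ?h * d"
        by (simp_all add: m field_simps)
      have ring: "e * (e * (k * k * x * (2 * x - 1) * ((x - 1) * (2 * x - 1) - 2 * (x - 1)))) =
        (2 * x - k * (x * (2 * x - 1)) * e) * ((2 * x - 1) - k * ((2 * x - 1) * (x - 1)) * e)
        - (2 * x - 1) * (x - 2 * k * x * (x - 1) * e) * (2 - k * e)" for e k x :: "int poly fract"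
        by algebra
      show ?thesis unfolding g n by (rule ring)
    qed
    finally show "I 2 (?g (2 * c + 2) * ?g (2 * c + 1) - ?R * ?g 2)" .
  qed (intro I)
  also have "cong 2 \<dots> (?R * ?D)" by (intro cong_mult cong_refl cong_sym[OF D] I)
  finally have BD: "cong 2 (?B * ?D) (?R * ?D)" .
  have D0: "?D \<noteq> 0" unfolding mult_2 using p by (rule qbinom_neq_0)
  have "cong 1 ?D (?g 2)" using D by (rule cong_mono) simp
  also have "cong 1 \<dots> 2"
  proof (rule congI)
    have "I 1 (- (of_nat h * (of_nat 2 * (of_nat 2 - 1) / 2)) * d)"
      by (intro I_mult_left I)
    thus "I 1 (?g 2 - 2)" by simp
  qed (intro I)
  finally have "I 1 (?D - 2)" unfolding cong_def by blast
  with D0 have u: "unit ?D" by (rule unit_near_unit[OF _ _ unit_numeral])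
  have "cong 2 (?B * ?D / ?D) (?R * ?D / ?D)"
    by (intro cong_divide BD cong_refl unit_imp_I0 u)
  thus ?thesis unfolding d_def nonzero_mult_div_cancel_right[OF D0] .
qed

text \<open>The sign (-1)^n comes from (-q)^n in the summand k = n; the rest is 1 or 2m - 1, the
  value modulo Phi_n of [mn, n] in base q^2 divided by m. The same factor, up to sign, turns up in
  the summands with n/2 < k < n.\<close>

definition sgn_coeff :: "nat \<Rightarrow> int poly fract" where
  "sgn_coeff m = (-1) ^ n * ((1 + (-1) ^ n) * (of_nat m - 1) + 1)"

lemma sgn_coeff_odd: "odd n \<Longrightarrow> sgn_coeff m = - 1"
  and sgn_coeff_even: "even n \<Longrightarrow> sgn_coeff m = 2 * of_nat m - 1"
  by (simp_all add: sgn_coeff_def algebra_simps)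

lemma I0_sgn_coeff: "I 0 (sgn_coeff m)"
  unfolding sgn_coeff_def by (intro I0_intros)

text \<open>The head numerator 1 - q^(2mn) supplies 2m(1 - q^n), so the other factors are needed
  modulo Phi_n only. Since n < 2k < 2n, the denominator 1 - q^(2k) is a unit.\<close>

lemma qbinom_sq_cong:
  assumes "m > 0" "k < n" "n < 2 * k"
  shows "cong 2 (qbinom (qvar\<^sup>2) (int (m * n)) (int k))
    ((1 - qvar ^ n) * (2 * of_nat m * (- sgn_coeff m) * ((-1) ^ (k - 1) / (qvar\<^sup>2) ^ (k choose 2)) / (1 - qvar ^ (2 * k))))"
proof -
  have u: "unit (1 - qvar ^ (2 * k))" by (rule unit_1_minus_qvar_power, rule not_dvd_double) (use assms in auto)
  define X where "X = (\<Prod>l=1..<k. (1 - qvar ^ (2 * (m * n - l))) / (1 - qvar ^ (2 * l)))"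
  \<comment> \<open>Correction to the generic value -1/q^(2l). At 2l = n the factor is (1 -
    q^(n(2m-1)))/(1 - q^n), which is 2m - 1 modulo Phi_n, whereas the generic value is -1.\<close>
  define w where "w l = (if 2 * l = n then - (2 * of_nat m - 1) else (1 :: int poly fract))" for l
  have kle: "k \<le> m * n" using assms mult_le_mono1[of 1 m n] by linarith
  have "cong 1 X (\<Prod>l=1..<k. w l * (- 1 / qvar ^ (2 * l)))"
    unfolding X_def
  proof (rule cong_prod)
    fix l assume "l \<in> {1..<k}"
    hence l: "0 < l" "l < k" by auto
    have e: "2 * (m * n - l) = 2 * (m * n) - 2 * l" by simp
    show "cong 1 ((1 - qvar ^ (2 * (m * n - l))) / (1 - qvar ^ (2 * l))) (w l * (- 1 / qvar ^ (2 * l)))"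
    proof (cases "2 * l = n")
      case False
      show ?thesis unfolding w_def e using False l assms kle not_dvd_double[of l n]
        by (simp only: if_False mult_1, intro qvar_ratio_cong) auto
    next
      case True
      have "2 * (m * n - l) = n * (2 * m - 1)" using True by (simp add: algebra_simps)
      hence "(1 - qvar ^ (2 * (m * n - l))) / (1 - qvar ^ (2 * l)) = (\<Sum>i<2 * m - 1. (qvar ^ n) ^ i)"
        unfolding True using n_pos qvar_power_neq_1
        by (simp only: power_mult) (intro geometric_quotient, simp)
      also have "cong 1 \<dots> (\<Sum>i<2 * m - 1. 1 ^ i)"
        by (intro cong_sum cong_power qvar_power_cong_1) simp
      also have "\<dots> = (- (2 * of_nat m - 1)) * (- 1 / 1)" using assms(1) by (simp add: of_nat_diff)
      also have "cong 1 \<dots> ((- (2 * of_nat m - 1)) * (- 1 / qvar ^ n))"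
        by (intro cong_mult cong_divide cong_sym[OF qvar_power_cong_1] cong_refl I0_intros unit_1 unit_power unit_qvar) simp
      finally show ?thesis unfolding w_def True by simp
    qed
  qed
  also have "(\<Prod>l=1..<k. w l * (- 1 / qvar ^ (2 * l))) = (\<Prod>l=1..<k. w l) * (\<Prod>l=1..<k. - 1 / (qvar\<^sup>2) ^ l)"
    by (simp only: prod.distrib qvar_sq_power)
  \<comment> \<open>For even n the exceptional index n/2 lies below k because n < 2k.\<close>
  also have "(\<Prod>l=1..<k. w l) = - sgn_coeff m"
  proof (cases "even n")
    case True
    then obtain h where h: "n = 2 * h" by (elim evenE)
    have "(\<Prod>l=1..<k. w l) = (\<Prod>l=1..<k. if l = h then - (2 * of_nat m - 1) else 1)"
      by (rule prod.cong) (auto simp: w_def h)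
    also have "\<dots> = - (2 * of_nat m - 1)"
      by (subst prod.delta) (use assms n_pos h in auto)
    finally show ?thesis using True by (simp add: sgn_coeff_even)
  next
    case False
    have "(\<Prod>l=1..<k. w l) = (\<Prod>l=1..<k. 1)"
      by (rule prod.cong) (use False in \<open>auto simp: w_def\<close>)
    thus ?thesis using False by (simp add: sgn_coeff_odd)
  qed
  also have "(\<Prod>l=1..<k. - 1 / (qvar\<^sup>2) ^ l) = (-1) ^ (k - 1) / (qvar\<^sup>2) ^ (k choose 2)"
    by (rule prod_uminus_inverse_powers) (use assms in simp)
  finally have X: "cong 1 X (- sgn_coeff m * ((-1) ^ (k - 1) / (qvar\<^sup>2) ^ (k choose 2)))" .
  have X0: "I 0 X" using X by (simp add: cong_def)
  have "qbinom (qvar\<^sup>2) (int (m * n)) (int k) = (1 - (qvar ^ n) ^ (2 * m)) * (X / (1 - qvar ^ (2 * k)))"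
    using assms kle unfolding X_def
    by (subst qbinom_conv_prod_head) (simp_all add: qvar_sq_power power_mult[symmetric] mult_ac)
  also have "cong 2 \<dots> (of_nat (2 * m) * (1 - qvar ^ n) * (X / (1 - qvar ^ (2 * k))))"
    by (intro cong_mult one_minus_power_cong I_1_minus_qvar_power_n cong_refl I_divide X0 u)
  also have "\<dots> = (1 - qvar ^ n) * (of_nat (2 * m) * (X / (1 - qvar ^ (2 * k))))" by (simp only: mult_ac)
  also have "cong 2 \<dots> ((1 - qvar ^ n) * (of_nat (2 * m) *
      (- sgn_coeff m * ((-1) ^ (k - 1) / (qvar\<^sup>2) ^ (k choose 2)) / (1 - qvar ^ (2 * k)))))"
    by (intro cong_mult_I1 I_1_minus_qvar_power_n cong_mult[OF cong_refl] cong_divide X cong_refl u unit_imp_I0[OF u] I0_of_nat)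
  finally show ?thesis by (simp add: mult_ac)
qed

section \<open>The summands of T_1\<close>

definition T1_summand :: "nat \<Rightarrow> nat \<Rightarrow> int poly fract" where
  "T1_summand m k = (- qvar) ^ k * qbinom (qvar\<^sup>2) (int (m * n)) (int k)
     * qbinom qvar (int (2 * m * n - 2 * k)) (int (n - k))"

definition lucas_term :: "nat \<Rightarrow> int poly fract" where
  "lucas_term j = (-1) ^ j * qvar ^ (j choose 2) / qvar ^ j * ((1 - qvar ^ n) / (1 - qvar ^ (n - j)))
     * qbinom qvar (int n - int j) (int j)"

lemma unit_small: "0 < i \<Longrightarrow> i < n \<Longrightarrow> unit (1 - qvar ^ i)"
  by (rule unit_1_minus_qvar_power) (auto dest: nat_dvd_not_less)

text \<open>Next to the explicit factor 1 - q^n, reflecting every exponent n - s to -s is allowed;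
  it turns [n-j, j] into a shifted form of [2j, j]. Strictness of 2j < n keeps 1 - q^(2j)
  invertible.\<close>

lemma lucas_term_cong:
  assumes "0 < j" "2 * j < n"
  shows "cong 2 (lucas_term j)
    ((1 - qvar ^ n) * (- (qbinom qvar (int (2 * j)) (int j) / ((1 - qvar ^ (2 * j)) * qvar ^ (j * j)))))"
proof -
  note uq = unit_power[OF unit_qvar]
  have u: "unit (1 - qvar ^ j)" "unit (1 - qvar ^ (n - j))" "unit (1 - qvar ^ (2 * j))"
    using assms by (auto intro!: unit_small)
  have nz: "1 - qvar ^ j \<noteq> 0" "1 - qvar ^ (2 * j) \<noteq> 0" using u by (auto simp only: dest: unit_imp_nonzero)
  define C where "C = qbinom qvar (int (2 * j)) (int j)"
  have "qbinom qvar (int n - int j) (int j) = qbinom qvar (int (n - j)) (int j)"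
    using assms by (simp add: of_nat_diff)
  also have "\<dots> = (\<Prod>i=1..j. (1 - qvar ^ (n - (j + i - 1))) / (1 - qvar ^ i))"
    using assms
    by (subst qbinom_conv_prod) (auto intro!: prod.cong arg_cong2[where f = "(/)"] arg_cong[where f = "\<lambda>x. 1 - qvar ^ x"])
  also have "cong 1 \<dots> (\<Prod>i=1..j. (- (1 - qvar ^ (j + i - 1)) / qvar ^ (j + i - 1)) / (1 - qvar ^ i))"
  proof (rule cong_prod)
    fix i assume "i \<in> {1..j}"
    hence i: "0 < i" "i \<le> j" by auto
    have "unit (1 - qvar ^ i)" by (rule unit_small) (use i assms in auto)
    thus "cong 1 ((1 - qvar ^ (n - (j + i - 1))) / (1 - qvar ^ i))
       ((- (1 - qvar ^ (j + i - 1)) / qvar ^ (j + i - 1)) / (1 - qvar ^ i))"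
      by (intro cong_divide one_minus_qvar_reflect cong_refl unit_imp_I0) (use i assms in auto)
  qed
  also have "(\<Prod>i=1..j. (- (1 - qvar ^ (j + i - 1)) / qvar ^ (j + i - 1)) / (1 - qvar ^ i))
    = (\<Prod>i=1..j. - 1 / qvar ^ (j + i - 1)) * (\<Prod>i=1..j. (1 - qvar ^ (j + i - 1)) / (1 - qvar ^ i))"
  proof -
    have "(- x / y) / z = - 1 / y * (x / z)" for x y z :: "int poly fract" by simp
    thus ?thesis by (simp only: prod.distrib[symmetric])
  qed
  also have "(\<Prod>i=1..j. - 1 / qvar ^ (j + i - 1)) = (-1) ^ j / (qvar ^ (j * j) * qvar ^ (j choose 2))"
  proof -
    \<comment> \<open>The upper limit is separated from the \<open>j\<close> in the exponent so that
      induction applies.\<close>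
    have "(\<Prod>i=1..k. - 1 / qvar ^ (j + i - 1)) = (-1) ^ k / (qvar ^ (j * k) * qvar ^ (k choose 2))" for k
      by (induction k) (simp_all add: Suc_choose_2 power_add binomial_eq_0 field_simps)
    thus ?thesis .
  qed
  also have "(\<Prod>i=1..j. (1 - qvar ^ (j + i - 1)) / (1 - qvar ^ i)) = C * (1 - qvar ^ j) / (1 - qvar ^ (2 * j))"
    unfolding C_def by (rule qbinom_shift_central[OF qvar_power_neq_1 assms(1)])
  finally have L: "cong 1 (qbinom qvar (int n - int j) (int j))
    ((-1) ^ j / (qvar ^ (j * j) * qvar ^ (j choose 2)) * (C * (1 - qvar ^ j) / (1 - qvar ^ (2 * j))))" .
  have R: "cong 1 (1 / (1 - qvar ^ (n - j))) (1 / (- (1 - qvar ^ j) / qvar ^ j))"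
  proof (intro cong_divide one_minus_qvar_reflect cong_refl I0_1 u)
    show "unit (- (1 - qvar ^ j) / qvar ^ j)" by (intro unit_divide unit_uminus u uq)
  qed (use assms in auto)
  have "lucas_term j = (1 - qvar ^ n) * ((-1) ^ j * qvar ^ (j choose 2) / qvar ^ j * (1 / (1 - qvar ^ (n - j)))
     * qbinom qvar (int n - int j) (int j))"
    unfolding lucas_term_def by simp
  also have "cong 2 \<dots> ((1 - qvar ^ n) * ((-1) ^ j * qvar ^ (j choose 2) / qvar ^ j * (1 / (- (1 - qvar ^ j) / qvar ^ j))
     * ((-1) ^ j / (qvar ^ (j * j) * qvar ^ (j choose 2)) * (C * (1 - qvar ^ j) / (1 - qvar ^ (2 * j))))))"
    by (intro cong_mult_I1 I_1_minus_qvar_power_n cong_mult L R cong_divide cong_refl I0_intros uq)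
  also have "(-1) ^ j * qvar ^ (j choose 2) / qvar ^ j * (1 / (- (1 - qvar ^ j) / qvar ^ j))
     * ((-1) ^ j / (qvar ^ (j * j) * qvar ^ (j choose 2)) * (C * (1 - qvar ^ j) / (1 - qvar ^ (2 * j))))
    = - (C / ((1 - qvar ^ (2 * j)) * qvar ^ (j * j)))"
  proof -
    have *: "s * a / b * (1 / (- x / b)) * (s / (c * a) * (C * x / y)) = - (C / (y * c))"
      if "s * s = 1" "a \<noteq> 0" "b \<noteq> 0" "c \<noteq> 0" "x \<noteq> 0" "y \<noteq> 0" for s a b c x y :: "int poly fract"
      using that by (simp add: field_simps)
    show ?thesis by (rule *) (use nz qvar_nonzero in \<open>auto simp flip: power_mult_distrib\<close>)
  qed
  finally show ?thesis unfolding C_def .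
qed

text \<open>With k = n - j, the upper index 2mn - 2k is 2j modulo n, so the second q-binomial
  becomes [2j, j], and the summand meets the expression found in
  \<open>lucas_term_cong\<close>.\<close>

lemma T1_summand_cong:
  assumes "m > 0" "0 < j" "2 * j < n"
  shows "cong 2 (T1_summand m (n - j)) (2 * of_nat m * sgn_coeff m * lucas_term j)"
proof -
  define k where "k = n - j"
  have k: "0 < k" "k < n" "n < 2 * k" "n - k = j" "n = k + j" using assms by (auto simp: k_def)
  note uq = unit_power[OF unit_qvar]
  have uj: "unit (1 - qvar ^ (2 * j))" using assms by (intro unit_small) auto
  have uk: "unit (1 - qvar ^ (2 * k))"
    by (rule unit_1_minus_qvar_power, rule not_dvd_double) (use k in auto)
  define C where "C = qbinom qvar (int (2 * j)) (int j)"
  define Cq where "Cq = qbinom qvar (int (2 * m * n - 2 * k)) (int (n - k))"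
  define V where "V = (-1) ^ (k - 1) / (qvar\<^sup>2) ^ (k choose 2)"
  have C: "cong 1 Cq C"
  proof -
    obtain c where c: "m = Suc c" using assms(1) by (cases m) auto
    have "2 * m * n - 2 * k = (2 * c * n + j) + j" unfolding c using k by (simp add: algebra_simps)
    hence "Cq = (\<Prod>i=1..j. (1 - qvar ^ (2 * c * n + j + i)) / (1 - qvar ^ i))"
      unfolding Cq_def k(4) by (simp only: qbinom_conv_prod_rev)
    also have "cong 1 \<dots> (\<Prod>i=1..j. (1 - qvar ^ (j + i)) / (1 - qvar ^ i))"
    proof (rule cong_prod)
      fix i assume i: "i \<in> {1..j}"
      have u: "unit (1 - qvar ^ i)" by (rule unit_small) (use i assms in auto)
      have "(2 * c * n + j + i) mod n = (j + i) mod n" by (simp add: add.assoc)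
      thus "cong 1 ((1 - qvar ^ (2 * c * n + j + i)) / (1 - qvar ^ i)) ((1 - qvar ^ (j + i)) / (1 - qvar ^ i))"
        by (intro cong_divide cong_diff qvar_power_cong cong_refl I0_1 u unit_imp_I0)
    qed
    also have "\<dots> = C" unfolding C_def mult_2 by (rule qbinom_conv_prod_rev[symmetric])
    finally show ?thesis .
  qed
  have W: "cong 1 ((- qvar) ^ k * (V / (1 - qvar ^ (2 * k)))) (1 / (1 - qvar ^ (2 * j)) / qvar ^ (j * j))"
  proof -
    have "(- qvar) ^ k * (-1) ^ (k - 1) = - (qvar ^ k)"
      by (rule minus_power_mult_sign[OF k(1)])
    \<comment> \<open>Expanding by q^k completes the denominator exponent k(k-1) to k^2, which is
      j^2 modulo n, and leaves -q^(2k) as numerator.\<close>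
    moreover have "(qvar\<^sup>2) ^ (k choose 2) * qvar ^ k = qvar ^ (k * k)"
      unfolding qvar_sq_power double_choose_2 power_add[symmetric] using k(1)
      by (intro arg_cong[where f = "\<lambda>x. qvar ^ x"]) (cases k; simp)
    moreover have "s * (t / b / y) = - (a * a) / y / c"
      if "s * t = - a" "b * a = c" "a \<noteq> 0" "b \<noteq> 0" for s t a b c y :: "int poly fract"
    proof -
      have "s * (t / b / y) = (s * t) / b / y" by simp
      also have "\<dots> = - (a * a) / y / (b * a)" unfolding that(1) using that(3,4) by simp
      finally show ?thesis using that by simp
    qed
    ultimately have "(- qvar) ^ k * (V / (1 - qvar ^ (2 * k))) =
        - (qvar ^ k * qvar ^ k) / (1 - qvar ^ (2 * k)) / qvar ^ (k * k)"
      unfolding V_def using qvar_nonzero by simp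
    also have "cong 1 \<dots> (1 / (1 - qvar ^ (2 * j)) / qvar ^ (j * j))"
    proof (rule cong_divide)
      have "k * k + 2 * j * n = j * j + n * n" unfolding k(5) by (simp add: algebra_simps)
      hence "(k * k) mod n = (j * j) mod n" by (metis mod_mult_self1)
      thus "cong 1 (qvar ^ (k * k)) (qvar ^ (j * j))" by (rule qvar_power_cong)
      have q2: "qvar ^ (2 * n) = qvar ^ (2 * k) * qvar ^ (2 * j)"
        unfolding k(5) by (simp add: power_add[symmetric] distrib_left)
      \<comment> \<open>Used with x = q^(2k) and y = q^(2j), where xy = q^(2n) is 1 modulo
        Phi_n.\<close>
      have "- x / (1 - x) - 1 / (1 - y) = - ((1 - x * y) / ((1 - x) * (1 - y)))"
        if "1 - x \<noteq> 0" "1 - y \<noteq> 0" for x y :: "int poly fract"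
        using that by (simp add: divide_simps) (simp add: algebra_simps)
      from this[OF unit_imp_nonzero[OF uk] unit_imp_nonzero[OF uj]]
      have "- (qvar ^ k * qvar ^ k) / (1 - qvar ^ (2 * k)) - 1 / (1 - qvar ^ (2 * j)) =
        - ((1 - qvar ^ (2 * n)) / ((1 - qvar ^ (2 * k)) * (1 - qvar ^ (2 * j))))"
        unfolding q2 by (simp only: power_add[symmetric] mult_2)
      moreover have "I 1 (- ((1 - qvar ^ (2 * n)) / ((1 - qvar ^ (2 * k)) * (1 - qvar ^ (2 * j)))))"
        by (intro I_uminus I_divide unit_mult uk uj I_1_minus_qvar_power) simp
      ultimately have "I 1 (- (qvar ^ k * qvar ^ k) / (1 - qvar ^ (2 * k)) - 1 / (1 - qvar ^ (2 * j)))"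
        by (simp only:)
      thus "cong 1 (- (qvar ^ k * qvar ^ k) / (1 - qvar ^ (2 * k))) (1 / (1 - qvar ^ (2 * j)))"
        by (rule congI) (intro I0_intros uj)
    qed (rule uq)+
    finally show ?thesis .
  qed
  have Cq0: "I 0 Cq" using C by (simp add: cong_def)
  have "T1_summand m k = (- qvar) ^ k * qbinom (qvar\<^sup>2) (int (m * n)) (int k) * Cq"
    unfolding T1_summand_def Cq_def ..
  also have "cong 2 \<dots> ((- qvar) ^ k *
     ((1 - qvar ^ n) * (2 * of_nat m * (- sgn_coeff m) * V / (1 - qvar ^ (2 * k)))) * Cq)"
    unfolding V_def by (intro cong_mult[OF cong_mult[OF cong_refl qbinom_sq_cong] cong_refl] assms k Cq0 I0_intros)
  also have "\<dots> = (1 - qvar ^ n) * (2 * of_nat m * (- sgn_coeff m) * ((- qvar) ^ k * (V / (1 - qvar ^ (2 * k)))) * Cq)"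
    by (simp add: mult_ac)
  also have "cong 2 \<dots> ((1 - qvar ^ n) * (2 * of_nat m * (- sgn_coeff m) * (1 / (1 - qvar ^ (2 * j)) / qvar ^ (j * j)) * C))"
    by (intro cong_mult_I1 I_1_minus_qvar_power_n cong_mult[OF cong_mult[OF cong_refl W] C] I0_intros I0_sgn_coeff)
  also have "\<dots> = 2 * of_nat m * sgn_coeff m * ((1 - qvar ^ n) * (- (C / ((1 - qvar ^ (2 * j)) * qvar ^ (j * j)))))"
    by (simp add: mult_ac)
  also have "cong 2 \<dots> (2 * of_nat m * sgn_coeff m * lucas_term j)"
    unfolding C_def
    by (intro cong_mult[OF cong_refl cong_sym[OF lucas_term_cong]] assms I0_intros I0_sgn_coeff)
  finally show ?thesis unfolding k_def .
qed

text \<open>At j = k = n/2 the two q-binomials exchange roles: the one in base q^2 is 2m modulo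
  Phi_n, and the factor (2m-1)(1 - q^n) comes from the head of the one in base q.\<close>

lemma T1_summand_half_cong:
  assumes "m > 0" "n = 2 * h"
  shows "cong 2 (T1_summand m h) (2 * of_nat m * sgn_coeff m * lucas_term h)"
proof -
  note uq = unit_power[OF unit_qvar]
  have h: "0 < h" "h < n" "n - h = h" using assms(2) n_pos by auto
  have u: "unit (1 - qvar ^ h)" using h by (intro unit_small)
  define N where "N = n * (2 * m - 1)"
  have N: "2 * m * n - 2 * h = N" unfolding N_def assms(2)[symmetric] by (simp add: algebra_simps)
  have hN: "h \<le> N" using assms n_pos unfolding N_def by (cases m) auto
  define Ah where "Ah = qbinom (qvar\<^sup>2) (int (m * n)) (int h)"
  define V where "V = (-1) ^ (h - 1) / qvar ^ (h choose 2)"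
  define X where "X = (\<Prod>l=1..<h. (1 - qvar ^ (N - l)) / (1 - qvar ^ l))"
  have A: "cong 1 Ah (2 * of_nat m)"
  proof -
    have mn: "m * n = (2 * m) * h" using assms(2) by simp
    have "cong 1 Ah (of_nat (2 * m) - of_nat h * (of_nat (2 * m) * (of_nat (2 * m) - 1) / 2) * (1 - qvar ^ n))"
      unfolding Ah_def mn by (rule cong_mono[OF qbinom_half_cong]) (use assms in auto)
    also have "cong 1 \<dots> (of_nat (2 * m) - 0)"
      by (intro cong_diff cong_refl I0_of_nat)
         (simp only: cong_0_iff, intro I_mult_left I_1_minus_qvar_power_n I0_intros unit_numeral)
    finally show ?thesis by simp
  qed
  have "cong 1 X (\<Prod>l=1..<h. - 1 / qvar ^ l)"
    unfolding X_def
  proof (rule cong_prod)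
    fix l assume l: "l \<in> {1..<h}"
    hence "\<not> n dvd l" using h by (auto dest!: dvd_imp_le)
    thus "cong 1 ((1 - qvar ^ (N - l)) / (1 - qvar ^ l)) (- 1 / qvar ^ l)"
      by (intro qvar_ratio_cong) (use l hN in \<open>auto simp: N_def\<close>)
  qed
  also have "(\<Prod>l=1..<h. - 1 / qvar ^ l) = V" unfolding V_def by (rule prod_uminus_inverse_powers[OF h(1)])
  finally have X: "cong 1 X V" .
  have X0: "I 0 X" using X by (simp add: cong_def)
  have "qbinom qvar (int N) (int h) = (1 - (qvar ^ n) ^ (2 * m - 1)) * (X / (1 - qvar ^ h))"
    unfolding qbinom_conv_prod_head[OF h(1) hN] X_def by (simp add: N_def power_mult)
  also have "cong 2 \<dots> (of_nat (2 * m - 1) * (1 - qvar ^ n) * (X / (1 - qvar ^ h)))"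
    by (intro cong_mult one_minus_power_cong I_1_minus_qvar_power_n cong_refl I_divide X0 u)
  finally have B: "cong 2 (qbinom qvar (int N) (int h)) (of_nat (2 * m - 1) * (1 - qvar ^ n) * (X / (1 - qvar ^ h)))" .
  have W: "cong 1 ((- qvar) ^ h * V) ((-1) ^ h * qvar ^ (h choose 2) / qvar ^ h)"
  proof (rule congI)
    \<comment> \<open>From 1 - q^n = (1 - q^h)(1 + q^h), where the first factor is a unit.\<close>
    have qh: "cong 1 (qvar ^ h) (- 1)"
    proof (rule congI)
      have "1 - qvar ^ n = (1 - qvar ^ h) * (qvar ^ h + 1)"
        unfolding assms(2) mult_2 power_add by (simp add: algebra_simps)
      hence "qvar ^ h - - 1 = (1 - qvar ^ n) / (1 - qvar ^ h)"
        using unit_imp_nonzero[OF u] by simp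
      thus "I 1 (qvar ^ h - - 1)" using I_divide[OF I_1_minus_qvar_power_n u] by simp
    qed (intro I0_intros)
    have s: "(-1) ^ h * (-1) ^ (h - 1) = (- 1 :: int poly fract)"
      using minus_power_mult_sign[OF h(1), of "1 :: int poly fract"] by simp
    \<comment> \<open>This is the numerator of the difference of the two sides over a common
      denominator, written in powers of q^h; replacing q^h by -1 makes it 0.\<close>
    have "cong 1 (- ((qvar ^ h)\<^sup>2) - (-1) ^ h * (qvar ^ h) ^ (h - 1)) (- ((- 1)\<^sup>2) - (-1) ^ h * (- 1) ^ (h - 1))"
      using cong_diff[OF cong_diff[OF cong_refl[OF I_0] cong_power[OF qh, of 2]]
         cong_mult[OF cong_refl cong_power[OF qh, of "h - 1"]], of "(-1) ^ h"]
      by (simp add: I0_intros)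
    hence I: "I 1 (- ((qvar ^ h)\<^sup>2) - (-1) ^ h * (qvar ^ h) ^ (h - 1))" unfolding s by (simp add: cong_0_iff)
    have s': "(- qvar) ^ h * (-1) ^ (h - 1) = - (qvar ^ h)"
      by (rule minus_power_mult_sign[OF h(1)])
    have c: "(qvar ^ h) ^ (h - 1) = qvar ^ (h choose 2) * qvar ^ (h choose 2)"
      unfolding power_mult[symmetric] double_choose_2[symmetric] by (simp add: mult_2 power_add)
    have "x * (t / b) - e * b / a = (- (a\<^sup>2) - e * (b * b)) / (b * a)"
      if "x * t = - a" "a \<noteq> 0" "b \<noteq> 0" for x t a b e :: "int poly fract"
    proof -
      have "x * (t / b) = - a / b" using that by simp
      thus ?thesis using that(2,3) by (simp add: field_simps power2_eq_square)
    qed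
    from this[OF s', of "qvar ^ (h choose 2)" "(-1) ^ h"]
    have "(- qvar) ^ h * V - (-1) ^ h * qvar ^ (h choose 2) / qvar ^ h =
      (- ((qvar ^ h)\<^sup>2) - (-1) ^ h * (qvar ^ h) ^ (h - 1)) / (qvar ^ (h choose 2) * qvar ^ h)"
      unfolding V_def c using qvar_nonzero by simp
    thus "I 1 ((- qvar) ^ h * V - (-1) ^ h * qvar ^ (h choose 2) / qvar ^ h)"
      using I_divide[OF I unit_mult[OF uq uq]] by simp
  qed (intro I0_intros uq)
  have "T1_summand m h = (- qvar) ^ h * Ah * qbinom qvar (int N) (int h)"
    unfolding T1_summand_def N h(3) Ah_def ..
  also have "cong 2 \<dots> ((- qvar) ^ h * Ah * (of_nat (2 * m - 1) * (1 - qvar ^ n) * (X / (1 - qvar ^ h))))"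
    using A by (intro cong_mult[OF cong_refl B] I0_intros) (simp add: cong_def)
  also have "\<dots> = (1 - qvar ^ n) * (of_nat (2 * m - 1) * ((- qvar) ^ h * (Ah * (X / (1 - qvar ^ h)))))"
    by (simp only: mult_ac)
  also have "cong 2 \<dots> ((1 - qvar ^ n) * (of_nat (2 * m - 1) * ((- qvar) ^ h * (2 * of_nat m * (V / (1 - qvar ^ h))))))"
    by (intro cong_mult_I1 I_1_minus_qvar_power_n cong_mult[OF cong_refl] cong_mult[OF A] cong_divide X cong_refl
        I0_intros u unit_imp_I0[OF u])
  also have "\<dots> = (1 - qvar ^ n) * (of_nat (2 * m - 1) * (2 * of_nat m * ((- qvar) ^ h * V / (1 - qvar ^ h))))"
    by (simp add: mult_ac)
  also have "cong 2 \<dots> ((1 - qvar ^ n) * (of_nat (2 * m - 1) * (2 * of_nat m *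
      ((-1) ^ h * qvar ^ (h choose 2) / qvar ^ h / (1 - qvar ^ h)))))"
    by (intro cong_mult_I1 I_1_minus_qvar_power_n cong_mult[OF cong_refl] cong_divide W cong_refl
        I0_intros u unit_imp_I0[OF u])
  also have "\<dots> = 2 * of_nat m * sgn_coeff m * lucas_term h"
  proof -
    have "int n - int h = int h" using assms(2) by simp
    hence l: "lucas_term h = (-1) ^ h * qvar ^ (h choose 2) / qvar ^ h * ((1 - qvar ^ n) / (1 - qvar ^ h))"
      unfolding lucas_term_def h(3) by (simp add: qbinom_self[OF qvar_power_neq_1])
    have s: "sgn_coeff m = of_nat (2 * m - 1)"
    proof -
      have "even n" using assms(2) by simp
      thus ?thesis using assms(1) by (simp add: sgn_coeff_even of_nat_diff)
    qed
    show ?thesis unfolding l s by (simp add: mult_ac)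
  qed
  finally show ?thesis .
qed

text \<open>Each of the two q-binomials contributes one factor Phi_n, and all denominators are
  units.\<close>

lemma T1_summand_small:
  assumes "m > 0" "0 < k" "2 * k < n"
  shows "I 2 (T1_summand m k)"
proof -
  have kle: "k \<le> m * n" "n \<le> m * n" using assms mult_le_mono1[of 1 m n] by linarith+
  have u: "unit (1 - (qvar\<^sup>2) ^ l)" if "0 < l" "l \<le> k" for l
    unfolding qvar_sq_power using that assms by (intro unit_small) auto
  have e: "I 1 (1 - (qvar\<^sup>2) ^ (m * n))"
    unfolding qvar_sq_power by (rule I_1_minus_qvar_power) simp
  have A: "I 1 (qbinom (qvar\<^sup>2) (int (m * n)) (int k))"
    unfolding qbinom_conv_prod_head[OF assms(2) kle(1)]
    by (intro e I_mult_right I_divide I0_prod u I0_intros) (use assms in auto)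
  let ?f = "\<lambda>i. (1 - qvar ^ (2 * m * n - 2 * k + 1 - i)) / (1 - qvar ^ i)"
  \<comment> \<open>The index whose numerator exponent is n(2m - 1); it lies in the range because k
    >= 1.\<close>
  let ?i = "n - 2 * k + 1"
  have u': "unit (1 - qvar ^ i)" if "i \<in> {1..n - k}" for i
    using that assms by (intro unit_small) auto
  have i: "?i \<in> {1..n - k}" using assms by auto
  have "n - k \<le> 2 * m * n - 2 * k" using kle assms by linarith
  hence "qbinom qvar (int (2 * m * n - 2 * k)) (int (n - k)) = (\<Prod>i=1..n - k. ?f i)"
    by (rule qbinom_conv_prod)
  also have "\<dots> = ?f ?i * (\<Prod>i\<in>{1..n - k} - {?i}. ?f i)"
    by (rule prod.remove) (use i in auto)
  also have "I 1 \<dots>"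
  proof (intro I_mult_right I_divide I0_prod u' i)
    have "2 * m * n - 2 * k + 1 - ?i = n * (2 * m - 1)"
      using kle assms by (simp add: algebra_simps)
    thus "I 1 (1 - qvar ^ (2 * m * n - 2 * k + 1 - ?i))"
      by (simp only:) (rule I_1_minus_qvar_power, simp)
  qed (use u' in \<open>auto intro!: I0_intros\<close>)
  finally have B: "I 1 (qbinom qvar (int (2 * m * n - 2 * k)) (int (n - k)))" .
  show ?thesis unfolding T1_summand_def
    by (intro I_mult_1_1 I_mult_left A B I0_intros)
qed

lemma T1_summand_n_cong:
  assumes "m > 0"
  shows "cong 2 (T1_summand m n)
    (sgn_coeff m * (of_nat m * qvar ^ n - of_nat n * of_nat m * (of_nat m - 1) * (1 - qvar ^ n)))"
proof -
  let ?d = "1 - qvar ^ n"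
  let ?Y = "of_nat n * of_nat m * (of_nat m - 1) :: int poly fract"
  let ?s = "(1 + (-1) ^ n) * (of_nat m - 1) + 1 :: int poly fract"
  have B: "cong 2 (qbinom (qvar\<^sup>2) (int (m * n)) (int n)) (?s * (of_nat m - ?Y * ?d))"
  proof (cases "even n")
    case True
    hence "?s = 2 * of_nat m - 1" by (simp add: algebra_simps)
    thus ?thesis using qbinom_sq_n_cong_even[OF assms True] by (simp only:)
  next
    case False
    hence "?s = 1" by simp
    thus ?thesis using qbinom_sq_n_cong_odd[OF assms False] by (simp only: mult_1)
  qed
  have "T1_summand m n = (-1) ^ n * qvar ^ n * qbinom (qvar\<^sup>2) (int (m * n)) (int n)"
    unfolding T1_summand_def by (simp add: qbinom_0_right power_minus[of qvar])
  also have "cong 2 \<dots> ((-1) ^ n * qvar ^ n * (?s * (of_nat m - ?Y * ?d)))"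
    by (intro cong_mult[OF cong_refl B] I0_intros)
  also have "cong 2 \<dots> (sgn_coeff m * (of_nat m * qvar ^ n - ?Y * ?d))"
  proof (rule congI)
    \<comment> \<open>Only the part already multiplied by 1 - q^n may lose its factor q^n; the error
      has a second factor 1 - q^n. The other part keeps m q^n.\<close>
    have "I 2 (?d * (?d * (sgn_coeff m * ?Y)))"
      by (intro I_mult_1_1 I_mult_right I_1_minus_qvar_power_n I0_sgn_coeff I0_intros)
    also have "?d * (?d * (sgn_coeff m * ?Y)) =
        (-1) ^ n * qvar ^ n * (?s * (of_nat m - ?Y * ?d)) - sgn_coeff m * (of_nat m * qvar ^ n - ?Y * ?d)"
    proof -
      have "(1 - x) * ((1 - x) * (e * s * y)) = e * x * (s * (a - y * (1 - x))) - e * s * (a * x - y * (1 - x))"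
        for x e s y a :: "int poly fract" by algebra
      thus ?thesis unfolding sgn_coeff_def .
    qed
    finally show "I 2 \<dots>" .
  qed (intro I0_intros I0_sgn_coeff)
  finally show ?thesis .
qed

section \<open>Assembly of the sum\<close>

lemma T1_conv_sum:
  assumes "m > 0"
  shows "T1 (m * n) ((int m - 1) * int n) qvar = (\<Sum>k=0..n. T1_summand m k)"
proof -
  have le: "n \<le> m * n" using assms by simp
  have e: "int (m * n) - (int m - 1) * int n - int k = int n - int k" for k
    by (simp add: algebra_simps)
  \<comment> \<open>The lower index N - M - k is n - k, negative for k > n, so the summation stops
    at n.\<close>
  have "T1 (m * n) ((int m - 1) * int n) qvar = (\<Sum>k=0..n. (- qvar) ^ k * qbinom (qvar\<^sup>2) (int (m * n)) (int k)
     * qbinom qvar (2 * int (m * n) - 2 * int k) (int n - int k))"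
    unfolding T1_def e by (rule sum.mono_neutral_right) (use le in \<open>auto simp: qbinom_eq_0\<close>)
  also have "\<dots> = (\<Sum>k=0..n. T1_summand m k)"
  proof (rule sum.cong)
    fix k assume k: "k \<in> {0..n}"
    have "2 * k \<le> 2 * (m * n)" using k le by (meson atLeastAtMost_iff mult_le_mono2 order_trans)
    hence "2 * int (m * n) - 2 * int k = int (2 * m * n - 2 * k)"
      by (simp add: of_nat_diff mult.assoc)
    moreover have "int n - int k = int (n - k)" using k by auto
    ultimately
    show "(- qvar) ^ k * qbinom (qvar\<^sup>2) (int (m * n)) (int k)
       * qbinom qvar (2 * int (m * n) - 2 * int k) (int n - int k) = T1_summand m k"
      unfolding T1_summand_def by (simp only:)
  qed simp
  finally show ?thesis .
qed

lemma sum_T1_summand_cong: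
  assumes "m > 0"
  shows "cong 2 (\<Sum>k=1..<n. T1_summand m k) (2 * of_nat m * sgn_coeff m * (Bn n qvar - 1))"
proof -
  let ?c = "2 * of_nat m * sgn_coeff m"
  have "(\<Sum>k=1..<n. T1_summand m k) = (\<Sum>j=1..<n. T1_summand m (n - j))"
    by (rule sum.reindex_bij_witness[of _ "\<lambda>j. n - j" "\<lambda>k. n - k"]) auto
  also have "cong 2 \<dots> (\<Sum>j=1..<n. if 2 * j \<le> n then ?c * lucas_term j else 0)"
  proof (rule cong_sum)
    fix j assume "j \<in> {1..<n}"
    hence j: "0 < j" "j < n" by auto
    consider "2 * j < n" | "n = 2 * j" | "n < 2 * j" by linarith
    thus "cong 2 (T1_summand m (n - j)) (if 2 * j \<le> n then ?c * lucas_term j else 0)"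
    proof cases
      case 1
      thus ?thesis using T1_summand_cong[OF assms j(1) 1] by simp
    next
      case 2
      have "n - j = j" "2 * j \<le> n" using 2 by auto
      thus ?thesis using T1_summand_half_cong[OF assms 2] by (simp only: if_True)
    next
      case 3
      hence "I 2 (T1_summand m (n - j))" using j by (intro T1_summand_small assms) auto
      thus ?thesis using 3 by (simp add: cong_0_iff)
    qed
  qed
  also have "(\<Sum>j=1..<n. if 2 * j \<le> n then ?c * lucas_term j else 0) = (\<Sum>j=1..n div 2. ?c * lucas_term j)"
    by (rule sum.mono_neutral_cong_right) (use n_pos in auto)
  also have "\<dots> = ?c * (Bn n qvar - 1)"
    unfolding Bn_expansion[OF qvar_power_neq_1 qvar_nonzero n_pos] lucas_term_def
    by (simp add: sum_distrib_left)
  finally show ?thesis .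
qed

lemma T1_cong:
  assumes "m > 0"
  shows "cong 2 (T1 (m * n) ((int m - 1) * int n) qvar)
    (2 * of_nat m - of_nat n * of_nat m * (2 * of_nat m - 1) * (1 - qvar ^ n)
      + sgn_coeff m * (of_nat m * qvar ^ n - of_nat n * of_nat m * (of_nat m - 1) * (1 - qvar ^ n)
           + 2 * of_nat m * (Bn n qvar - 1)))"
proof -
  have "T1_summand m 0 = qbinom qvar (int (2 * m * n)) (int n)"
    unfolding T1_summand_def by (simp add: qbinom_0_right)
  \<comment> \<open>The multiplier is a = 2m, so a(a-1)/2 is m(2m-1).\<close>
  also have "cong 2 \<dots> (of_nat (2 * m) - of_nat n * (of_nat (2 * m) * (of_nat (2 * m) - 1) / 2) * (1 - qvar ^ n))"
    by (rule qbinom_n_cong) (use assms in simp)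
  also have "\<dots> = 2 * of_nat m - of_nat n * of_nat m * (2 * of_nat m - 1) * (1 - qvar ^ n)"
    by simp
  finally have 0: "cong 2 (T1_summand m 0) \<dots>" .
  have "T1 (m * n) ((int m - 1) * int n) qvar =
      T1_summand m 0 + ((\<Sum>k=1..<n. T1_summand m k) + T1_summand m n)"
    unfolding T1_conv_sum[OF assms]
    using n_pos sum.atLeast_Suc_atMost[of 0 n "T1_summand m"] sum.last_plus[of 1 n "T1_summand m"]
    by (simp add: add.commute)
  also have "cong 2 \<dots> (2 * of_nat m - of_nat n * of_nat m * (2 * of_nat m - 1) * (1 - qvar ^ n)
      + (2 * of_nat m * sgn_coeff m * (Bn n qvar - 1)
        + sgn_coeff m * (of_nat m * qvar ^ n - of_nat n * of_nat m * (of_nat m - 1) * (1 - qvar ^ n))))"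
    by (intro cong_add 0 sum_T1_summand_cong T1_summand_n_cong assms)
  finally show ?thesis by (simp only: distrib_left add_ac mult_ac)
qed

end

theorem theorem1p3:
  fixes m n :: nat
  assumes "m > 0" and "n > 0"
  shows "ratfun_cong
    (T1 (m * n) ((int m - 1) * int n) qvar)
    (2 * of_nat m - of_nat n * of_nat m * (2 * of_nat m - 1) * (1 - qvar ^ n)
      + (-1) ^ n * ((1 + (-1) ^ n) * (of_nat m - 1) + 1)
        * (of_nat m * qvar ^ n - of_nat n * of_nat m * (of_nat m - 1) * (1 - qvar ^ n)
           + 2 * of_nat m * (Bn n qvar - 1)))
    ((cyclotomic n)\<^sup>2)"
proof -
  interpret cyclotomic_localization n by unfold_locales (rule assms(2))
  show ?thesis
    using T1_cong[OF assms(1)] unfolding cong_def sgn_coeff_def by (intro I_imp_ratfun_cong) blast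
qed

end
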